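(* Let $G$ be a finite group and let $H$ be a subgroup of $G$. Then the permutation character $(1_H)^G$ has a unique real-valued irreducible constituent of $+$ type if and only if $[G:\mathrm{core}_G(H)]$ is odd.
   Context: Characters are complex characters. $(1_H)^G$ is the character of $G$ induced from the trivial character $1_H$ of $H$. $\mathrm{core}_G(H)=\bigcap_{g\in G}H^g$ is the largest normal subgroup of $G$ contained in $H$. For an irreducible character $\chi$ of $G$, its Frobenius-Schur indicator is $\nu_2(\chi)=|G|^{-1}\sum_{g\in G}\chi(g^2)\in\{0,1,-1\}$, and $\chi$ is of $+$ type if $\nu_2(\chi)=1$, equivalently if $\chi$ is afforded by a representation defined over $\mathbb{R}$. *)

theory Defs
  imports "HOL-Algebra.Coset" "Jordan_Normal_Form.VS_Connect"
begin

definition general_linear_group :: "nat \<Rightarrow> complex mat monoid" where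
  "general_linear_group n = units_of (ring_mat TYPE(complex) n ())"

definition matrix_representation ::
  "('a, 'b) monoid_scheme \<Rightarrow> nat \<Rightarrow> ('a \<Rightarrow> complex mat) \<Rightarrow> bool" where
  "matrix_representation G n \<rho> \<longleftrightarrow> n > 0 \<and> \<rho> \<in> hom G (general_linear_group n)"

text \<open>The qualified name selects the carrier-based notion of subspace, not the one for
  type-class vector spaces.\<close>

definition irreducible_representation ::
  "('a, 'b) monoid_scheme \<Rightarrow> nat \<Rightarrow> ('a \<Rightarrow> complex mat) \<Rightarrow> bool" where
  "irreducible_representation G n \<rho> \<longleftrightarrow>
     matrix_representation G n \<rho> \<and>
     (\<forall>W. VectorSpace.subspace class_ring W (module_vec TYPE(complex) n) \<and>
          (\<forall>g\<in>carrier G. \<forall>w\<in>W. \<rho> g *\<^sub>v w \<in> W) \<longrightarrow>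
          W = {0\<^sub>v n} \<or> W = carrier_vec n)"

definition mat_trace :: "complex mat \<Rightarrow> complex" where
  "mat_trace A = (\<Sum>i<dim_row A. A $$ (i, i))"

text \<open>Class functions and characters are restricted to the carrier, i.e. \<open>undefined\<close> outside it,
  so that equality of HOL functions is equality on the group.\<close>

definition afforded_character ::
  "('a, 'b) monoid_scheme \<Rightarrow> ('a \<Rightarrow> complex mat) \<Rightarrow> 'a \<Rightarrow> complex" where
  "afforded_character G \<rho> = (\<lambda>g\<in>carrier G. mat_trace (\<rho> g))"

definition is_character :: "('a, 'b) monoid_scheme \<Rightarrow> ('a \<Rightarrow> complex) \<Rightarrow> bool" where
  "is_character G \<chi> \<longleftrightarrow>
     (\<exists>n \<rho>. matrix_representation G n \<rho> \<and> \<chi> = afforded_character G \<rho>)"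

definition irreducible_character :: "('a, 'b) monoid_scheme \<Rightarrow> ('a \<Rightarrow> complex) \<Rightarrow> bool" where
  "irreducible_character G \<chi> \<longleftrightarrow>
     (\<exists>n \<rho>. irreducible_representation G n \<rho> \<and> \<chi> = afforded_character G \<rho>)"

text \<open>A character \<open>\<chi>\<close> is a constituent of \<open>\<psi>\<close> if \<open>\<psi> - \<chi>\<close> is a character or zero (characters
  have positive degree here).\<close>

definition constituent ::
  "('a, 'b) monoid_scheme \<Rightarrow> ('a \<Rightarrow> complex) \<Rightarrow> ('a \<Rightarrow> complex) \<Rightarrow> bool" where
  "constituent G \<chi> \<psi> \<longleftrightarrow> is_character G \<chi> \<and>
     (let \<theta> = (\<lambda>g\<in>carrier G. \<psi> g - \<chi> g)
      in is_character G \<theta> \<or> (\<forall>g\<in>carrier G. \<theta> g = 0))"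

definition principal_character :: "'a set \<Rightarrow> 'a \<Rightarrow> complex" where
  "principal_character H = (\<lambda>h\<in>H. 1)"

definition induced_character ::
  "('a, 'b) monoid_scheme \<Rightarrow> 'a set \<Rightarrow> ('a \<Rightarrow> complex) \<Rightarrow> 'a \<Rightarrow> complex" where
  "induced_character G H \<phi> = (\<lambda>g\<in>carrier G.
     (\<Sum>x\<in>carrier G.
        if x \<otimes>\<^bsub>G\<^esub> g \<otimes>\<^bsub>G\<^esub> inv\<^bsub>G\<^esub> x \<in> H then \<phi> (x \<otimes>\<^bsub>G\<^esub> g \<otimes>\<^bsub>G\<^esub> inv\<^bsub>G\<^esub> x) else 0)
     / of_nat (card H))"

definition frobenius_schur_indicator ::
  "('a, 'b) monoid_scheme \<Rightarrow> ('a \<Rightarrow> complex) \<Rightarrow> complex" where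
  "frobenius_schur_indicator G \<chi> =
     (\<Sum>g\<in>carrier G. \<chi> (g [^]\<^bsub>G\<^esub> (2::nat))) / of_nat (Coset.order G)"

definition plus_type :: "('a, 'b) monoid_scheme \<Rightarrow> ('a \<Rightarrow> complex) \<Rightarrow> bool" where
  "plus_type G \<chi> \<longleftrightarrow> frobenius_schur_indicator G \<chi> = 1"

definition real_valued :: "('a, 'b) monoid_scheme \<Rightarrow> ('a \<Rightarrow> complex) \<Rightarrow> bool" where
  "real_valued G \<chi> \<longleftrightarrow> (\<forall>g\<in>carrier G. \<chi> g \<in> \<real>)"

definition conjugate_subgroup :: "('a, 'b) monoid_scheme \<Rightarrow> 'a set \<Rightarrow> 'a \<Rightarrow> 'a set" where
  "conjugate_subgroup G H g = (\<lambda>h. inv\<^bsub>G\<^esub> g \<otimes>\<^bsub>G\<^esub> h \<otimes>\<^bsub>G\<^esub> g) ` H"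

definition normal_core :: "('a, 'b) monoid_scheme \<Rightarrow> 'a set \<Rightarrow> 'a set" where
  "normal_core G H = (\<Inter>g\<in>carrier G. conjugate_subgroup G H g)"

definition subgroup_index :: "('a, 'b) monoid_scheme \<Rightarrow> 'a set \<Rightarrow> nat" where
  "subgroup_index G K = card (rcosets\<^bsub>G\<^esub> K)"

end

theory Submission
  imports Defs "Jordan_Normal_Form.Char_Poly" "HOL-Algebra.Sylow" "HOL-Algebra.Multiplicative_Group"
begin

text \<open>Write \<open>\<pi>\<close> for the permutation character and decompose it into irreducible characters. Since
  \<open>\<Sum>g. \<pi> g = |G|\<close>, the principal character occurs exactly once, and it is of \<open>+\<close> type. Counting gives
  \<open>\<Sum>g. \<pi>(g\<^sup>2) = |G| |{g. g\<^sup>2 \<in> H}| / |H|\<close>, so the Frobenius-Schur indicators of the constituents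
  of \<open>\<pi>\<close> add up to \<open>|{g. g\<^sup>2 \<in> H}| / |H|\<close>. If the index of the core is even, an involution modulo
  the core has a conjugate \<open>g \<notin> H\<close> with \<open>g\<^sup>2 \<in> H\<close>; the sum then exceeds 1 and forces a second
  constituent of \<open>+\<close> type. If the index is odd, squaring permutes the quotient by the core, and the core
  acts trivially in every constituent \<open>\<chi>\<close>; so the indicator of \<open>\<chi>\<close> equals the average of \<open>\<chi>\<close>,
  which vanishes unless \<open>\<chi>\<close> is principal.\<close>

section \<open>Complex matrices and invariant subspaces\<close>

text \<open>The two directions make different demands. For even index it suffices to look at the
  members of one fixed list of irreducible characters with sum \<open>\<pi>\<close>. For odd index
  an arbitrary constituent must be handled, and uniqueness of decompositions is not at hand to place
  it in that list; hence triviality of the core is obtained by comparing averages over the core for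
  \<open>\<chi>\<close>, for \<open>\<pi> - \<chi>\<close> and for \<open>\<pi>\<close>. Of the
  orthogonality relations only one case enters: a nonprincipal irreducible character sums to zero
  over the group. The hard ingredient is that an indicator lies in {0, 1, -1} and that a nonzero one
  forces real values. The definition as an average shows neither, so invariant bilinear forms are
  classified at the level of matrices. Subspaces are made concrete by bases adapted to them; these
  yield both the splitting of reducible characters and the rank of an idempotent.\<close>

definition lin_subspace :: "nat \<Rightarrow> complex vec set \<Rightarrow> bool" where
  "lin_subspace n W \<longleftrightarrow> W \<subseteq> carrier_vec n \<and> 0\<^sub>v n \<in> W \<and>
     (\<forall>v\<in>W. \<forall>w\<in>W. v + w \<in> W) \<and> (\<forall>c. \<forall>v\<in>W. c \<cdot>\<^sub>v v \<in> W)"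

lemma subspace_iff_lin_subspace:
  "VectorSpace.subspace class_ring W (module_vec TYPE(complex) n) \<longleftrightarrow> lin_subspace n W"
proof -
  interpret vec_space "TYPE(complex)" n .
  show ?thesis
    unfolding VectorSpace.subspace_def submodule_def lin_subspace_def
    using vectorspace_axioms module_axioms by (auto simp: module_vec_def)
qed

lemma mult_mat_vec_index:
  assumes "A \<in> carrier_mat n m" "v \<in> carrier_vec m" "i < n"
  shows "(A *\<^sub>v v) $ i = (\<Sum>j<m. A $$ (i, j) * v $ j)"
  using assms by (auto simp: scalar_prod_def atLeast0LessThan intro!: sum.cong)

lemma mult_mat_index:
  assumes "A \<in> carrier_mat n m" "B \<in> carrier_mat m l" "i < n" "j < l"
  shows "(A * B) $$ (i, j) = (\<Sum>k<m. A $$ (i, k) * B $$ (k, j))"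
  using assms by (auto simp: scalar_prod_def atLeast0LessThan intro!: sum.cong)

lemma trivial_kernel_inverse:
  fixes A :: "'a::field mat"
  assumes A: "A \<in> carrier_mat n n"
    and ker: "\<And>v. v \<in> carrier_vec n \<Longrightarrow> A *\<^sub>v v = 0\<^sub>v n \<Longrightarrow> v = 0\<^sub>v n"
  obtains B where "B \<in> carrier_mat n n" "A * B = 1\<^sub>m n" "B * A = 1\<^sub>m n"
proof -
  have "det A \<noteq> 0" using det_0_iff_vec_prod_zero_field[OF A] ker by blast
  from det_non_zero_imp_unit[OF A this, of "()"] show ?thesis
    using that by (auto simp: Units_def ring_mat_def)
qed

lemma eq_if_inverse_mult_vec:
  fixes P :: "'a::comm_ring_1 mat"
  assumes "P \<in> carrier_mat n n" "Q \<in> carrier_mat n n" "Q * P = 1\<^sub>m n" "v \<in> carrier_vec n"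
  shows "Q *\<^sub>v (P *\<^sub>v v) = v"
  by (metis assms assoc_mult_mat_vec one_mult_mat_vec)

text \<open>An exchange argument: among all invertible \<open>P\<close> having the columns indexed
  by \<open>S\<close> in \<open>W\<close>, take one with \<open>S\<close> as large as possible. A
  vector of \<open>W\<close> with a nonzero coordinate outside \<open>S\<close> could replace that
  column and enlarge \<open>S\<close>. Letting \<open>S\<close> be any set of indices, not an
  initial segment, avoids permuting columns.\<close>

lemma adapted_basis:
  assumes W: "lin_subspace n W"
  obtains S P Q where "S \<subseteq> {..<n}" "P \<in> carrier_mat n n" "Q \<in> carrier_mat n n"
    "P * Q = 1\<^sub>m n" "Q * P = 1\<^sub>m n"
    "W = {P *\<^sub>v v | v. v \<in> carrier_vec n \<and> (\<forall>i<n. i \<notin> S \<longrightarrow> v $ i = 0)}"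
proof -
  define good where "good S P Q \<longleftrightarrow> S \<subseteq> {..<n} \<and> P \<in> carrier_mat n n \<and> Q \<in> carrier_mat n n
     \<and> P * Q = 1\<^sub>m n \<and> Q * P = 1\<^sub>m n \<and> (\<forall>j\<in>S. P *\<^sub>v unit_vec n j \<in> W)" for S and P Q :: "complex mat"
  have "good {} (1\<^sub>m n) (1\<^sub>m n)" by (auto simp: good_def)
  moreover have "card S \<le> n" if "good S P Q" for S P Q
    using that card_mono[of "{..<n}" S] by (auto simp: good_def)
  ultimately obtain S where "\<exists>P Q. good S P Q" and max: "\<And>T. \<exists>P Q. good T P Q \<Longrightarrow> card T \<le> card S"
    using ex_has_greatest_nat[of "\<lambda>S. \<exists>P Q. good S P Q" "{}" card "Suc n"]
    by (metis le_imp_less_Suc less_imp_le_nat)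
  then obtain P Q where SPQ: "good S P Q" by blast
  note g = SPQ[unfolded good_def]
  have W0: "0\<^sub>v n \<in> W" and WC: "W \<subseteq> carrier_vec n"
    and Wadd: "\<And>v w. v \<in> W \<Longrightarrow> w \<in> W \<Longrightarrow> v + w \<in> W" and Wsm: "\<And>c v. v \<in> W \<Longrightarrow> c \<cdot>\<^sub>v v \<in> W"
    using W by (auto simp: lin_subspace_def)
  have PQc: "P \<in> carrier_mat n n" "Q \<in> carrier_mat n n" using g by auto
  have finS: "finite S" using g finite_subset by blast
  \<comment> \<open>Stated for every subset \<open>T\<close> of \<open>S\<close>, so that one
    coordinate can be split off in each induction step.\<close>
  have sup: "P *\<^sub>v v \<in> W" if "v \<in> carrier_vec n" "\<forall>i<n. i \<notin> T \<longrightarrow> v $ i = 0" "T \<subseteq> S" for v T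
    using finite_subset[OF that(3) finS] that
  proof (induction T arbitrary: v rule: finite_induct)
    case empty
    then have "v = 0\<^sub>v n" by (intro eq_vecI) auto
    moreover have "P *\<^sub>v 0\<^sub>v n = 0\<^sub>v n" using g by (intro eq_vecI) auto
    ultimately show ?case using W0 by auto
  next
    case (insert j T)
    let ?v = "vec n (\<lambda>i. if i = j then 0 else v $ i)"
    have j: "j < n" "j \<in> S" using insert.prems g by auto
    have eq: "v = ?v + v $ j \<cdot>\<^sub>v unit_vec n j" using insert.prems j by (intro eq_vecI) auto
    have "P *\<^sub>v v = P *\<^sub>v ?v + v $ j \<cdot>\<^sub>v (P *\<^sub>v unit_vec n j)"
      using g by (subst eq) (simp add: mult_add_distrib_mat_vec[of _ n n] mult_mat_vec[of _ n n])
    moreover have "P *\<^sub>v ?v \<in> W" using insert.prems by (intro insert.IH) auto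
    ultimately show ?case using g j Wadd Wsm by auto
  qed
  have sub: "w \<in> {P *\<^sub>v v | v. v \<in> carrier_vec n \<and> (\<forall>i<n. i \<notin> S \<longrightarrow> v $ i = 0)}" if w: "w \<in> W" for w
  proof -
    define v where "v = Q *\<^sub>v w"
    have wc: "w \<in> carrier_vec n" using w WC by auto
    have v: "v \<in> carrier_vec n" using g wc by (auto simp: v_def)
    have Pv: "P *\<^sub>v v = w" unfolding v_def using g wc by (intro eq_if_inverse_mult_vec) auto
    have "v $ j = 0" if j: "j < n" "j \<notin> S" for j
    proof (rule ccontr)
      assume vj: "v $ j \<noteq> 0"
      \<comment> \<open>\<open>E\<close> is the identity with column \<open>j\<close> replaced by
        the coordinate vector \<open>v\<close> of \<open>w\<close>. Thus \<open>P * E\<close> is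
        \<open>P\<close> with column \<open>j\<close> replaced by \<open>w\<close>, and
        \<open>E\<close> is invertible because \<open>v $ j\<close> is nonzero.\<close>
      define E where "E = mat n n (\<lambda>(a, b). if b = j then v $ a else if a = b then 1 else 0)"
      have E: "E \<in> carrier_mat n n" by (simp add: E_def)
      have Ei: "(E *\<^sub>v x) $ i = (if i = j then 0 else x $ i) + v $ i * x $ j"
        if "x \<in> carrier_vec n" "i < n" for x i
      proof -
        have "(E *\<^sub>v x) $ i = (\<Sum>b<n. (if b = j then v $ i * x $ j else 0)
                + (if b = i then (if i = j then 0 else x $ i) else 0))"
          unfolding mult_mat_vec_index[OF E that]
          by (rule sum.cong) (use that j in \<open>auto simp: E_def\<close>)
        then show ?thesis using that j by (simp add: sum.distrib)
      qed
      obtain F where F: "F \<in> carrier_mat n n" "E * F = 1\<^sub>m n" "F * E = 1\<^sub>m n"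
      proof (rule trivial_kernel_inverse[OF E])
        fix x assume x: "x \<in> carrier_vec n" and Ex: "E *\<^sub>v x = 0\<^sub>v n"
        have xj: "x $ j = 0" using Ei[OF x j(1)] j vj Ex by simp
        have "x $ i = 0" if "i < n" for i using Ei[OF x that] Ex that xj by (auto split: if_splits)
        then show "x = 0\<^sub>v n" using x by (intro eq_vecI) auto
      qed auto
      have "good (insert j S) (P * E) (F * Q)"
        unfolding good_def
      proof (intro conjI ballI)
        have "P * E * (F * Q) = P * (E * F) * Q" using g E F(1) by (simp add: assoc_mult_mat[of _ n n _ n _ n])
        then show "P * E * (F * Q) = 1\<^sub>m n"
          using g PQc unfolding F(2) by (metis right_mult_one_mat)
        have "F * Q * (P * E) = F * (Q * P) * E" using PQc E F(1) by (simp add: assoc_mult_mat[of _ n n _ n _ n])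
        then show "F * Q * (P * E) = 1\<^sub>m n"
          using g F by (metis right_mult_one_mat)
        fix b assume b: "b \<in> insert j S"
        then have bn: "b < n" using j g by auto
        have "E *\<^sub>v unit_vec n b = (if b = j then v else unit_vec n b)"
          using Ei[of "unit_vec n b"] v E j bn by (intro eq_vecI) auto
        then have "P * E *\<^sub>v unit_vec n b = (if b = j then w else P *\<^sub>v unit_vec n b)"
          using g E Pv by (subst assoc_mult_mat_vec) auto
        then show "P * E *\<^sub>v unit_vec n b \<in> W" using b g w by auto
      qed (use g E F j in auto)
      then have "card (insert j S) \<le> card S" using max by blast
      then show False using j finS by simp
    qed
    then show ?thesis using v Pv by blast
  qed
  show ?thesis
    using that[of S P Q] g sup sub by blast
qed

section \<open>Traces, conjugation and idempotents\<close>

lemma mat_trace_eq: "A \<in> carrier_mat n n \<Longrightarrow> mat_trace A = (\<Sum>i<n. A $$ (i, i))"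
  by (auto simp: mat_trace_def)

lemma mat_trace_comm:
  assumes "A \<in> carrier_mat n m" "B \<in> carrier_mat m n"
  shows "mat_trace (A * B) = mat_trace (B * A)"
proof -
  have "mat_trace (A * B) = (\<Sum>i<n. \<Sum>k<m. A $$ (i, k) * B $$ (k, i))"
    using assms by (subst mat_trace_eq[of _ n]) (auto simp: mult_mat_index simp del: index_mult_mat intro!: sum.cong)
  also have "\<dots> = (\<Sum>k<m. \<Sum>i<n. B $$ (k, i) * A $$ (i, k))"
    by (subst sum.swap) (simp add: mult.commute)
  also have "\<dots> = mat_trace (B * A)"
    using assms by (subst mat_trace_eq[of _ m]) (auto simp: mult_mat_index simp del: index_mult_mat intro!: sum.cong)
  finally show ?thesis .
qed

lemma mat_trace_conj:
  assumes "A \<in> carrier_mat n n" "P \<in> carrier_mat n n" "Q \<in> carrier_mat n n" "P * Q = 1\<^sub>m n"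
  shows "mat_trace (Q * A * P) = mat_trace A"
proof -
  have "mat_trace (Q * (A * P)) = mat_trace (A * P * Q)"
    using assms by (intro mat_trace_comm) auto
  also have "A * P * Q = A" using assoc_mult_mat[OF assms(1-3)] assms by simp
  finally show ?thesis unfolding assoc_mult_mat[OF assms(3,1,2)] .
qed

lemma conj_mat_index:
  fixes A :: "'a::comm_ring_1 mat"
  assumes "A \<in> carrier_mat n n" "P \<in> carrier_mat n n" "Q \<in> carrier_mat n n" "i < n" "j < n"
  shows "(Q * A * P) $$ (i, j) = (Q *\<^sub>v (A *\<^sub>v (P *\<^sub>v unit_vec n j))) $ i"
proof -
  have "(Q * A * P) *\<^sub>v unit_vec n j = (Q * A) *\<^sub>v (P *\<^sub>v unit_vec n j)"
    by (rule assoc_mult_mat_vec) (use assms in auto)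
  also have "\<dots> = Q *\<^sub>v (A *\<^sub>v (P *\<^sub>v unit_vec n j))"
    by (rule assoc_mult_mat_vec) (use assms in auto)
  moreover have "((Q * A * P) *\<^sub>v unit_vec n j) $ i = (Q * A * P) $$ (i, j)"
    using assms by (simp add: scalar_prod_right_unit del: assoc_mult_mat)
  ultimately show ?thesis by simp
qed

text \<open>Hypothesis \<open>inv\<close> says in coordinates that \<open>A\<close> preserves the
  span of the columns of \<open>P\<close> indexed by \<open>S\<close>; in the basis \<open>P\<close>
  the matrix is therefore block triangular.\<close>

lemma invariant_block:
  fixes A :: "'a::comm_ring_1 mat"
  assumes A: "A \<in> carrier_mat n n" and P: "P \<in> carrier_mat n n" and Q: "Q \<in> carrier_mat n n"
    and QP: "Q * P = 1\<^sub>m n"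
    and inv: "\<And>v. v \<in> carrier_vec n \<Longrightarrow> (\<forall>i<n. i \<notin> S \<longrightarrow> v $ i = 0) \<Longrightarrow>
       \<exists>u. u \<in> carrier_vec n \<and> (\<forall>i<n. i \<notin> S \<longrightarrow> u $ i = 0) \<and> A *\<^sub>v (P *\<^sub>v v) = P *\<^sub>v u"
    and ij: "i < n" "i \<notin> S" "j \<in> S" "j < n"
  shows "(Q * A * P) $$ (i, j) = 0"
proof -
  have "(Q * A * P) $$ (i, j) = (Q *\<^sub>v (A *\<^sub>v (P *\<^sub>v unit_vec n j))) $ i"
    using conj_mat_index A P Q ij by blast
  also obtain u where u: "u \<in> carrier_vec n" "\<forall>i<n. i \<notin> S \<longrightarrow> u $ i = 0"
     "A *\<^sub>v (P *\<^sub>v unit_vec n j) = P *\<^sub>v u"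
    using inv[OF unit_vec_carrier, of j] ij by (metis index_unit_vec(1))
  then have "Q *\<^sub>v (A *\<^sub>v (P *\<^sub>v unit_vec n j)) = u"
    using P Q QP eq_if_inverse_mult_vec by auto
  finally show ?thesis using u ij by auto
qed

text \<open>The number \<open>m\<close> is the rank. In a basis adapted to the image, a basis vector
  indexed by \<open>S\<close> is fixed, which gives a diagonal entry 1; any other one is sent into
  the image, whose coordinates live on \<open>S\<close>, which gives a diagonal entry 0.\<close>

lemma idempotent_trace:
  assumes P: "A \<in> carrier_mat n n" and idem: "A * A = A"
  obtains m where "mat_trace A = of_nat m" "m = 0 \<Longrightarrow> A = 0\<^sub>m n n"
proof -
  define W where "W = {A *\<^sub>v v | v. v \<in> carrier_vec n}"
  have WA: "A *\<^sub>v w = w" if "w \<in> W" for w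
    using that P idem by (auto simp: W_def assoc_mult_mat_vec[symmetric])
  have "lin_subspace n W"
    unfolding lin_subspace_def
  proof (intro conjI ballI allI)
    show "W \<subseteq> carrier_vec n" using P by (auto simp: W_def)
    show "0\<^sub>v n \<in> W" unfolding W_def using P by (auto intro!: exI[of _ "0\<^sub>v n"] eq_vecI)
    fix v w assume "v \<in> W" "w \<in> W"
    then show "v + w \<in> W" using P unfolding W_def
      by clarsimp (metis add_carrier_vec mult_add_distrib_mat_vec)
  next
    fix c v assume "v \<in> W"
    then show "c \<cdot>\<^sub>v v \<in> W" using P unfolding W_def
      by clarsimp (metis smult_carrier_vec mult_mat_vec)
  qed
  from adapted_basis[OF this] obtain S B Q
    where S: "S \<subseteq> {..<n}" and B: "B \<in> carrier_mat n n" "Q \<in> carrier_mat n n"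
    "B * Q = 1\<^sub>m n" "Q * B = 1\<^sub>m n"
    and W: "W = {B *\<^sub>v v | v. v \<in> carrier_vec n \<and> (\<forall>i<n. i \<notin> S \<longrightarrow> v $ i = 0)}" .
  let ?M = "Q * A * B"
  have M: "?M \<in> carrier_mat n n" using P B by auto
  have diag: "?M $$ (i, i) = (if i \<in> S then 1 else 0)" if i: "i < n" for i
  proof -
    have eq: "?M $$ (i, i) = (Q *\<^sub>v (A *\<^sub>v (B *\<^sub>v unit_vec n i))) $ i"
      using conj_mat_index P B i by blast
    show ?thesis
    proof (cases "i \<in> S")
      case True
      then have "B *\<^sub>v unit_vec n i \<in> W" using W i by (auto intro!: exI[of _ "unit_vec n i"])
      then have "Q *\<^sub>v (A *\<^sub>v (B *\<^sub>v unit_vec n i)) = unit_vec n i"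
        using WA eq_if_inverse_mult_vec[of B n Q] B by auto
      then show ?thesis using True eq i by simp
    next
      case False
      have "A *\<^sub>v (B *\<^sub>v unit_vec n i) \<in> W" using B by (auto simp: W_def)
      then obtain u where "A *\<^sub>v (B *\<^sub>v unit_vec n i) = B *\<^sub>v u" "u \<in> carrier_vec n"
         "\<forall>i<n. i \<notin> S \<longrightarrow> u $ i = 0" using W by auto
      then show ?thesis using eq_if_inverse_mult_vec[of B n Q u] B False eq i by auto
    qed
  qed
  have "mat_trace A = mat_trace ?M" using mat_trace_conj[OF P B(1,2,3)] by simp
  also have "\<dots> = (\<Sum>i<n. if i \<in> S then 1 else 0)"
    unfolding mat_trace_eq[OF M] using diag by (intro sum.cong) auto
  also have "\<dots> = of_nat (card S)"
    using S by (simp add: sum.If_cases Int_absorb1 Int_absorb2)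
  finally have "mat_trace A = of_nat (card S)" .
  moreover have "A = 0\<^sub>m n n" if "card S = 0"
  proof -
    have "S = {}" using that S finite_subset by fastforce
    have W0: "w = 0\<^sub>v n" if w: "w \<in> W" for w
    proof -
      obtain v where "w = B *\<^sub>v v" "v \<in> carrier_vec n" "\<forall>i<n. v $ i = 0"
        using w W \<open>S = {}\<close> by auto
      moreover from this have "v = 0\<^sub>v n" by (intro eq_vecI) auto
      ultimately show ?thesis using B by (auto intro!: eq_vecI)
    qed
    show ?thesis
    proof (rule eq_matI)
      fix i j assume ij: "i < dim_row (0\<^sub>m n n :: complex mat)" "j < dim_col (0\<^sub>m n n :: complex mat)"
      have "A *\<^sub>v unit_vec n j = 0\<^sub>v n" by (rule W0) (auto simp: W_def)
      then have "(A *\<^sub>v unit_vec n j) $ i = 0" using ij by simp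
      then show "A $$ (i, j) = 0\<^sub>m n n $$ (i, j)" using ij P by (simp add: scalar_prod_right_unit)
    qed (use P in auto)
  qed
  ultimately show ?thesis by (rule that)
qed

section \<open>Matrix representations and their characters\<close>

context group
begin

text \<open>Invertibility of \<open>\<rho> g\<close> is automatic for a multiplicative map sending
  \<open>\<one>\<close> to the identity, with inverse \<open>\<rho> (inv g)\<close>; this leaves
  only equations to check.\<close>

lemma matrix_representation_iff:
  "matrix_representation G n \<rho> \<longleftrightarrow> n > 0 \<and> (\<forall>g\<in>carrier G. \<rho> g \<in> carrier_mat n n) \<and>
     (\<forall>g\<in>carrier G. \<forall>h\<in>carrier G. \<rho> (g \<otimes> h) = \<rho> g * \<rho> h) \<and> \<rho> \<one> = 1\<^sub>m n"
    (is "_ \<longleftrightarrow> ?R")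
proof
  interpret R: ring "ring_mat TYPE(complex) n ()" by (rule ring_mat)
  assume rep: "matrix_representation G n \<rho>"
  then have h: "\<rho> \<in> hom G (general_linear_group n)" by (simp add: matrix_representation_def)
  have "group (general_linear_group n)"
    unfolding general_linear_group_def by (rule R.units_group)
  from hom_one[OF h is_group this] have "\<rho> \<one> = 1\<^sub>m n"
    by (simp add: general_linear_group_def units_of_def ring_mat_def)
  then show ?R using rep h
    by (auto simp: matrix_representation_def hom_def general_linear_group_def units_of_def
        Units_def ring_mat_def Pi_def)
next
  assume r: ?R
  have "\<rho> g \<in> Units (ring_mat TYPE(complex) n ())" if "g \<in> carrier G" for g
  proof -
    have "\<rho> g * \<rho> (inv g) = 1\<^sub>m n" "\<rho> (inv g) * \<rho> g = 1\<^sub>m n"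
      using r that by (metis inv_closed r_inv, metis inv_closed l_inv)
    then show ?thesis using r that by (auto simp: Units_def ring_mat_def)
  qed
  then show "matrix_representation G n \<rho>" using r
    by (auto simp: matrix_representation_def hom_def general_linear_group_def units_of_def ring_mat_def)
qed

lemma
  assumes "matrix_representation G n \<rho>"
  shows rep_pos: "n > 0"
    and rep_carrier: "g \<in> carrier G \<Longrightarrow> \<rho> g \<in> carrier_mat n n"
    and rep_mult: "g \<in> carrier G \<Longrightarrow> h \<in> carrier G \<Longrightarrow> \<rho> (g \<otimes> h) = \<rho> g * \<rho> h"
    and rep_one: "\<rho> \<one> = 1\<^sub>m n"
    and rep_inv: "g \<in> carrier G \<Longrightarrow> \<rho> (inv g) * \<rho> g = 1\<^sub>m n"
      "g \<in> carrier G \<Longrightarrow> \<rho> g * \<rho> (inv g) = 1\<^sub>m n"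
  using assms unfolding matrix_representation_iff
  by (auto, metis inv_closed l_inv, metis inv_closed r_inv)

text \<open>Lets matrix coefficients be indexed by whatever finite set is natural: a disjoint union
  for direct sums, a set of coordinates for blocks, a set of cosets for permutation representations.
  An enumeration of \<open>I\<close> turns them into a matrix without affecting the trace.\<close>

lemma representation_indexed:
  fixes r :: "'a \<Rightarrow> 'i \<Rightarrow> 'i \<Rightarrow> complex"
  assumes I: "finite I" "I \<noteq> {}"
    and mult: "\<And>g h i j. \<lbrakk>g \<in> carrier G; h \<in> carrier G; i \<in> I; j \<in> I\<rbrakk> \<Longrightarrow>
       r (g \<otimes> h) i j = (\<Sum>k\<in>I. r g i k * r h k j)"
    and one: "\<And>i j. i \<in> I \<Longrightarrow> j \<in> I \<Longrightarrow> r \<one> i j = (if i = j then 1 else 0)"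
  obtains \<rho> where "matrix_representation G (card I) \<rho>"
    "\<And>g. g \<in> carrier G \<Longrightarrow> mat_trace (\<rho> g) = (\<Sum>i\<in>I. r g i i)"
proof -
  obtain e where e: "bij_betw e {..<card I} I"
    using ex_bij_betw_nat_finite[OF I(1)] by (auto simp: atLeast0LessThan)
  have eI: "e a \<in> I" if "a < card I" for a using e that by (auto simp: bij_betw_def)
  have einj: "e a = e b \<longleftrightarrow> a = b" if "a < card I" "b < card I" for a b
    using e that by (auto simp: bij_betw_def inj_on_def)
  define \<rho> where "\<rho> g = mat (card I) (card I) (\<lambda>(a, b). r g (e a) (e b))" for g
  have c: "\<rho> g \<in> carrier_mat (card I) (card I)" for g by (simp add: \<rho>_def)
  have "\<rho> (g \<otimes> h) = \<rho> g * \<rho> h" if "g \<in> carrier G" "h \<in> carrier G" for g h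
  proof (rule eq_matI)
    fix a b assume "a < dim_row (\<rho> g * \<rho> h)" "b < dim_col (\<rho> g * \<rho> h)"
    then have ab: "a < card I" "b < card I" by (auto simp: \<rho>_def)
    have "(\<Sum>k\<in>I. r g (e a) k * r h k (e b)) = (\<Sum>c<card I. r g (e a) (e c) * r h (e c) (e b))"
      by (rule sum.reindex_bij_betw[OF e, symmetric])
    then show "\<rho> (g \<otimes> h) $$ (a, b) = (\<rho> g * \<rho> h) $$ (a, b)"
      unfolding mult_mat_index[OF c c ab] using that ab eI by (simp add: \<rho>_def mult)
  qed (auto simp: \<rho>_def)
  moreover have "\<rho> \<one> = 1\<^sub>m (card I)"
    by (rule eq_matI) (auto simp: \<rho>_def eI einj one)
  moreover have "mat_trace (\<rho> g) = (\<Sum>i\<in>I. r g i i)" for g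
    unfolding mat_trace_eq[OF c] sum.reindex_bij_betw[OF e, symmetric]
    by (simp add: \<rho>_def)
  ultimately show ?thesis
    using that[of \<rho>] I c by (auto simp: matrix_representation_iff card_gt_0_iff)
qed

lemma representation_direct_sum:
  assumes r1: "matrix_representation G n \<rho>" and r2: "matrix_representation G m \<sigma>"
  obtains k \<tau> where "matrix_representation G k \<tau>"
    "\<And>g. g \<in> carrier G \<Longrightarrow> mat_trace (\<tau> g) = mat_trace (\<rho> g) + mat_trace (\<sigma> g)"
proof -
  let ?I = "{..<n} <+> {..<m}"
  define r where "r g i j = (case i of Inl a \<Rightarrow> (case j of Inl b \<Rightarrow> \<rho> g $$ (a, b) | Inr b \<Rightarrow> 0)
      | Inr a \<Rightarrow> (case j of Inl b \<Rightarrow> 0 | Inr b \<Rightarrow> \<sigma> g $$ (a, b)))" for g and i j :: "nat + nat"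
  obtain \<tau> where t: "matrix_representation G (card ?I) \<tau>"
    and tr: "\<And>g. g \<in> carrier G \<Longrightarrow> mat_trace (\<tau> g) = (\<Sum>i\<in>?I. r g i i)"
  proof (rule representation_indexed[of ?I r])
    show "?I \<noteq> {}" using rep_pos[OF r1] by auto
    show "r (g \<otimes> h) i j = (\<Sum>k\<in>?I. r g i k * r h k j)"
      if "g \<in> carrier G" "h \<in> carrier G" "i \<in> ?I" "j \<in> ?I" for g h i j
      using that rep_carrier[OF r1] rep_carrier[OF r2]
      by (auto simp: sum.Plus r_def rep_mult[OF r1] rep_mult[OF r2] mult_mat_index[of _ n n _ n]
          mult_mat_index[of _ m m _ m] simp del: index_mult_mat)
    show "r \<one> i j = (if i = j then 1 else 0)" if "i \<in> ?I" "j \<in> ?I" for i j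
      using that by (auto simp: r_def rep_one[OF r1] rep_one[OF r2] split: if_splits)
  qed auto
  have "mat_trace (\<tau> g) = mat_trace (\<rho> g) + mat_trace (\<sigma> g)" if "g \<in> carrier G" for g
    using tr[OF that] mat_trace_eq[OF rep_carrier[OF r1 that]] mat_trace_eq[OF rep_carrier[OF r2 that]]
    by (simp add: sum.Plus r_def)
  with t that show ?thesis by blast
qed

text \<open>Adding characters amounts to forming direct sums. The empty list is excluded because
  representations have positive degree, so the zero function is not a character.\<close>

lemma is_character_sum_list:
  assumes "cs \<noteq> []" "\<forall>c\<in>set cs. is_character G c"
  shows "is_character G (\<lambda>g\<in>carrier G. \<Sum>c\<leftarrow>cs. c g)"
  using assms
proof (induction cs rule: list_nonempty_induct)
  case (single c)
  then obtain n \<rho> where "matrix_representation G n \<rho>" "c = afforded_character G \<rho>"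
    by (auto simp: is_character_def)
  then show ?case unfolding is_character_def
    by (intro exI[of _ n] exI[of _ \<rho>]) (auto simp: afforded_character_def)
next
  case (cons c cs)
  then have "is_character G c" "is_character G (\<lambda>g\<in>carrier G. \<Sum>c\<leftarrow>cs. c g)"
    by (metis list.set_intros(1), metis list.set_intros(2))
  then obtain n \<rho> m \<sigma> where r: "matrix_representation G n \<rho>" "c = afforded_character G \<rho>"
      "matrix_representation G m \<sigma>" "(\<lambda>g\<in>carrier G. \<Sum>c\<leftarrow>cs. c g) = afforded_character G \<sigma>"
    unfolding is_character_def by blast
  from representation_direct_sum[OF r(1,3)] obtain k \<tau> where t: "matrix_representation G k \<tau>"
    "\<And>g. g \<in> carrier G \<Longrightarrow> mat_trace (\<tau> g) = mat_trace (\<rho> g) + mat_trace (\<sigma> g)" by blast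
  have "mat_trace (\<sigma> g) = (\<Sum>c\<leftarrow>cs. c g)" if "g \<in> carrier G" for g
    using fun_cong[OF r(4), of g] that by (simp add: afforded_character_def)
  then show ?case unfolding is_character_def using r t
    by (intro exI[of _ k] exI[of _ \<tau>]) (auto simp: afforded_character_def)
qed

section \<open>Splitting characters into irreducible ones\<close>

lemma irreducible_representation_iff:
  "irreducible_representation G n \<rho> \<longleftrightarrow> matrix_representation G n \<rho> \<and>
     (\<forall>W. lin_subspace n W \<and> (\<forall>g\<in>carrier G. \<forall>w\<in>W. \<rho> g *\<^sub>v w \<in> W) \<longrightarrow>
       W = {0\<^sub>v n} \<or> W = carrier_vec n)"
  unfolding irreducible_representation_def subspace_iff_lin_subspace ..

lemma irreducible_imp_is_character: "irreducible_character G \<chi> \<Longrightarrow> is_character G \<chi>"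
  by (auto simp: irreducible_character_def is_character_def irreducible_representation_def)

text \<open>Passing to an adapted basis of an invariant subspace makes the representation block
  triangular; for characters this suffices, so complete reducibility is not needed.\<close>

lemma reducible_character_splits:
  assumes rep: "matrix_representation G n \<rho>" and red: "\<not> irreducible_representation G n \<rho>"
  obtains k \<sigma> l \<tau> where "k < n" "l < n" "matrix_representation G k \<sigma>" "matrix_representation G l \<tau>"
    "\<And>g. g \<in> carrier G \<Longrightarrow> mat_trace (\<rho> g) = mat_trace (\<sigma> g) + mat_trace (\<tau> g)"
proof -
  obtain W where W: "lin_subspace n W" and inv: "\<And>g w. g \<in> carrier G \<Longrightarrow> w \<in> W \<Longrightarrow> \<rho> g *\<^sub>v w \<in> W"
    and proper: "W \<noteq> {0\<^sub>v n}" "W \<noteq> carrier_vec n"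
    using rep red unfolding irreducible_representation_iff by blast
  from adapted_basis[OF W] obtain S P Q where S: "S \<subseteq> {..<n}"
    and PQ: "P \<in> carrier_mat n n" "Q \<in> carrier_mat n n" "P * Q = 1\<^sub>m n" "Q * P = 1\<^sub>m n"
    and WP: "W = {P *\<^sub>v v | v. v \<in> carrier_vec n \<and> (\<forall>i<n. i \<notin> S \<longrightarrow> v $ i = 0)}" .
  let ?T = "{..<n} - S"
  have finS: "finite S" using S finite_subset by blast
  \<comment> \<open>As \<open>W\<close> is neither zero nor everything, both \<open>S\<close> and
    its complement are nonempty; this makes the two blocks have positive degree smaller than
    \<open>n\<close>.\<close>
  have S0: "S \<noteq> {}"
  proof
    assume "S = {}"
    have "w = 0\<^sub>v n" if w: "w \<in> W" for w
    proof -
      obtain v where "w = P *\<^sub>v v" "v \<in> carrier_vec n" "\<forall>i<n. v $ i = 0"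
        using w WP \<open>S = {}\<close> by auto
      moreover from this have "v = 0\<^sub>v n" by (intro eq_vecI) auto
      ultimately show ?thesis using PQ by (auto intro!: eq_vecI)
    qed
    then show False using proper W unfolding lin_subspace_def by blast
  qed
  have T0: "?T \<noteq> {}"
  proof
    assume T: "?T = {}"
    have "w \<in> W" if "w \<in> carrier_vec n" for w
      using that T PQ eq_if_inverse_mult_vec[of Q n P w] unfolding WP
      by (auto intro!: exI[of _ "Q *\<^sub>v w"])
    then show False using proper W unfolding lin_subspace_def by blast
  qed
  define M where "M g = Q * \<rho> g * P" for g
  have Mc: "M g \<in> carrier_mat n n" if "g \<in> carrier G" for g
    using rep_carrier[OF rep that] PQ by (simp add: M_def)
  have Mmult: "M (g \<otimes> h) = M g * M h" if gh: "g \<in> carrier G" "h \<in> carrier G" for g h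
  proof -
    note c = rep_carrier[OF rep gh(1)] rep_carrier[OF rep gh(2)] PQ(1,2)
    have "M g * M h = Q * \<rho> g * (P * (Q * (\<rho> h * P)))"
      unfolding M_def using c by (simp add: assoc_mult_mat[of _ n n _ n _ n])
    also have "P * (Q * (\<rho> h * P)) = P * Q * (\<rho> h * P)"
      using c by (simp add: assoc_mult_mat[of _ n n _ n _ n])
    also have "\<dots> = \<rho> h * P" unfolding PQ using c by simp
    also have "Q * \<rho> g * (\<rho> h * P) = M (g \<otimes> h)"
      unfolding M_def rep_mult[OF rep gh] using c by (simp add: assoc_mult_mat[of _ n n _ n _ n])
    finally show ?thesis ..
  qed
  have Mone: "M \<one> = 1\<^sub>m n" using PQ by (simp add: M_def rep_one[OF rep])
  have block: "M g $$ (i, j) = 0" if g: "g \<in> carrier G" and ij: "i \<in> ?T" "j \<in> S" for g i j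
    unfolding M_def
  proof (rule invariant_block[OF rep_carrier[OF rep g] PQ(1,2,4), where S = S])
    fix v :: "complex vec" assume "v \<in> carrier_vec n" "\<forall>i<n. i \<notin> S \<longrightarrow> v $ i = 0"
    then have "P *\<^sub>v v \<in> W" unfolding WP by blast
    from inv[OF g this] show "\<exists>u. u \<in> carrier_vec n \<and> (\<forall>i<n. i \<notin> S \<longrightarrow> u $ i = 0) \<and>
        \<rho> g *\<^sub>v (P *\<^sub>v v) = P *\<^sub>v u" unfolding WP by blast
  qed (use ij S in auto)
  have one: "M \<one> $$ (i, j) = (if i = j then 1 else 0)" if "i < n" "j < n" for i j
    using that by (simp add: Mone)
  have split: "(\<Sum>k<n. f k) = (\<Sum>k\<in>S. f k) + (\<Sum>k\<in>?T. f k)" for f :: "nat \<Rightarrow> complex"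
    using sum.subset_diff[OF S, of f] by (simp add: add.commute)
  \<comment> \<open>The block on \<open>S\<close> is the action on \<open>W\<close>, the block on
    the complement the action on the quotient by \<open>W\<close>. In the product formula for either
    block, the terms with \<open>k\<close> in the other index set contain an entry that vanishes by
    \<open>block\<close>.\<close>
  obtain \<sigma> where s: "matrix_representation G (card S) \<sigma>"
    "\<And>g. g \<in> carrier G \<Longrightarrow> mat_trace (\<sigma> g) = (\<Sum>i\<in>S. M g $$ (i, i))"
  proof (rule representation_indexed[of S "\<lambda>g i j. M g $$ (i, j)"])
    fix g h i j assume *: "g \<in> carrier G" "h \<in> carrier G" "i \<in> S" "j \<in> S"
    then show "M (g \<otimes> h) $$ (i, j) = (\<Sum>k\<in>S. M g $$ (i, k) * M h $$ (k, j))"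
      using S by (subst Mmult, simp, simp, subst mult_mat_index[of _ n n _ n])
        (auto simp: Mc split block)
  next
    show "M \<one> $$ (i, j) = (if i = j then 1 else 0)" if "i \<in> S" "j \<in> S" for i j
      using one that S by blast
  qed (use finS S0 in auto)
  obtain \<tau> where t: "matrix_representation G (card ?T) \<tau>"
    "\<And>g. g \<in> carrier G \<Longrightarrow> mat_trace (\<tau> g) = (\<Sum>i\<in>?T. M g $$ (i, i))"
  proof (rule representation_indexed[of ?T "\<lambda>g i j. M g $$ (i, j)"])
    fix g h i j assume *: "g \<in> carrier G" "h \<in> carrier G" "i \<in> ?T" "j \<in> ?T"
    then show "M (g \<otimes> h) $$ (i, j) = (\<Sum>k\<in>?T. M g $$ (i, k) * M h $$ (k, j))"
      using S by (subst Mmult, simp, simp, subst mult_mat_index[of _ n n _ n])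
        (auto simp: Mc split block)
  qed (use finS T0 S one in auto)
  have tr: "mat_trace (\<rho> g) = mat_trace (\<sigma> g) + mat_trace (\<tau> g)" if g: "g \<in> carrier G" for g
    using mat_trace_conj[OF rep_carrier[OF rep g] PQ(1-3)] s(2)[OF g] t(2)[OF g]
    by (simp add: M_def[symmetric] mat_trace_eq[OF Mc[OF g]] split)
  have "card S < card {..<n}" "card ?T < card {..<n}"
    using S T0 S0 by (intro psubset_card_mono; auto)+
  then show ?thesis using that[OF _ _ s(1) t(1) tr] by simp
qed

text \<open>Strong induction on the degree, splitting as long as the representation is reducible. A
  list is used so that multiplicities are retained.\<close>

lemma character_decomposition:
  assumes "matrix_representation G n \<rho>"
  obtains cs where "\<forall>c\<in>set cs. irreducible_character G c"
    "\<And>g. g \<in> carrier G \<Longrightarrow> mat_trace (\<rho> g) = (\<Sum>c\<leftarrow>cs. c g)"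
proof -
  have "\<exists>cs. (\<forall>c\<in>set cs. irreducible_character G c) \<and>
     (\<forall>g\<in>carrier G. mat_trace (\<rho> g) = (\<Sum>c\<leftarrow>cs. c g))"
    using assms
  proof (induction n arbitrary: \<rho> rule: less_induct)
    case (less n)
    show ?case
    proof (cases "irreducible_representation G n \<rho>")
      case True
      then have "irreducible_character G (afforded_character G \<rho>)"
        unfolding irreducible_character_def by blast
      then have "\<forall>c\<in>set [afforded_character G \<rho>]. irreducible_character G c" by simp
      moreover have "\<forall>g\<in>carrier G. mat_trace (\<rho> g) = (\<Sum>c\<leftarrow>[afforded_character G \<rho>]. c g)"
        by (simp add: afforded_character_def)
      ultimately show ?thesis by blast
    next
      case False
      obtain k \<sigma> l \<tau> where "k < n" "l < n"
        and s: "matrix_representation G k \<sigma>" and t: "matrix_representation G l \<tau>"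
        and tr: "\<And>g. g \<in> carrier G \<Longrightarrow> mat_trace (\<rho> g) = mat_trace (\<sigma> g) + mat_trace (\<tau> g)"
        by (rule reducible_character_splits[OF less.prems False]) (rule that)
      obtain cs ds where
        "\<forall>c\<in>set cs. irreducible_character G c" "\<forall>g\<in>carrier G. mat_trace (\<sigma> g) = (\<Sum>c\<leftarrow>cs. c g)"
        "\<forall>c\<in>set ds. irreducible_character G c" "\<forall>g\<in>carrier G. mat_trace (\<tau> g) = (\<Sum>c\<leftarrow>ds. c g)"
        using less.IH[OF \<open>k < n\<close> s] less.IH[OF \<open>l < n\<close> t] by blast
      then show ?thesis by (intro exI[of _ "cs @ ds"]) (auto simp: tr)
    qed
  qed
  with that show ?thesis by blast
qed

end

section \<open>Averaging over the group\<close>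

text \<open>The dimension is an explicit argument because the type of matrices does not determine
  it, and an empty sum must still be the zero matrix of the right size.\<close>

definition sum_mat :: "nat \<Rightarrow> ('i \<Rightarrow> complex mat) \<Rightarrow> 'i set \<Rightarrow> complex mat" where
  "sum_mat n F S = mat n n (\<lambda>(i, j). \<Sum>x\<in>S. F x $$ (i, j))"

lemma sum_mat_carrier: "sum_mat n F S \<in> carrier_mat n n"
  by (simp add: sum_mat_def)

lemma sum_mat_index: "i < n \<Longrightarrow> j < n \<Longrightarrow> sum_mat n F S $$ (i, j) = (\<Sum>x\<in>S. F x $$ (i, j))"
  by (simp add: sum_mat_def)

lemma sum_mat_cong: "(\<And>x. x \<in> S \<Longrightarrow> F x = F' x) \<Longrightarrow> sum_mat n F S = sum_mat n F' S"
  by (simp add: sum_mat_def)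

lemma sum_mat_reindex: "bij_betw h S T \<Longrightarrow> sum_mat n (\<lambda>x. F (h x)) S = sum_mat n F T"
  unfolding sum_mat_def
  using sum.reindex_bij_betw[of h S T "\<lambda>x. F x $$ (i, j)" for i j] by presburger

lemma mult_sum_mat:
  assumes "A \<in> carrier_mat n n" "\<And>x. x \<in> S \<Longrightarrow> F x \<in> carrier_mat n n"
  shows "A * sum_mat n F S = sum_mat n (\<lambda>x. A * F x) S"
proof (rule eq_matI)
  fix i j assume "i < dim_row (sum_mat n (\<lambda>x. A * F x) S)" "j < dim_col (sum_mat n (\<lambda>x. A * F x) S)"
  then have ij: "i < n" "j < n" by (auto simp: sum_mat_def)
  have "(A * sum_mat n F S) $$ (i, j) = (\<Sum>k<n. \<Sum>x\<in>S. A $$ (i, k) * F x $$ (k, j))"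
    unfolding mult_mat_index[OF assms(1) sum_mat_carrier ij]
    using ij by (intro sum.cong) (auto simp: sum_mat_index sum_distrib_left)
  also have "\<dots> = (\<Sum>x\<in>S. (A * F x) $$ (i, j))"
    by (subst sum.swap, intro sum.cong mult_mat_index[symmetric]) (use assms ij in auto)
  finally show "(A * sum_mat n F S) $$ (i, j) = sum_mat n (\<lambda>x. A * F x) S $$ (i, j)"
    using ij by (simp add: sum_mat_index)
qed (use assms in \<open>auto simp: sum_mat_def\<close>)

lemma sum_mat_mult:
  assumes "A \<in> carrier_mat n n" "\<And>x. x \<in> S \<Longrightarrow> F x \<in> carrier_mat n n"
  shows "sum_mat n F S * A = sum_mat n (\<lambda>x. F x * A) S"
proof (rule eq_matI)
  fix i j assume "i < dim_row (sum_mat n (\<lambda>x. F x * A) S)" "j < dim_col (sum_mat n (\<lambda>x. F x * A) S)"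
  then have ij: "i < n" "j < n" by (auto simp: sum_mat_def)
  have "(sum_mat n F S * A) $$ (i, j) = (\<Sum>k<n. \<Sum>x\<in>S. F x $$ (i, k) * A $$ (k, j))"
    unfolding mult_mat_index[OF sum_mat_carrier assms(1) ij]
    using ij by (intro sum.cong) (auto simp: sum_mat_index sum_distrib_right)
  also have "\<dots> = (\<Sum>x\<in>S. (F x * A) $$ (i, j))"
    by (subst sum.swap, intro sum.cong mult_mat_index[symmetric]) (use assms ij in auto)
  finally show "(sum_mat n F S * A) $$ (i, j) = sum_mat n (\<lambda>x. F x * A) S $$ (i, j)"
    using ij by (simp add: sum_mat_index)
qed (use assms in \<open>auto simp: sum_mat_def\<close>)

lemma mat_trace_sum_mat:
  assumes "\<And>x. x \<in> S \<Longrightarrow> F x \<in> carrier_mat n n"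
  shows "mat_trace (sum_mat n F S) = (\<Sum>x\<in>S. mat_trace (F x))"
proof -
  have "mat_trace (sum_mat n F S) = (\<Sum>i<n. \<Sum>x\<in>S. F x $$ (i, i))"
    unfolding mat_trace_eq[OF sum_mat_carrier] by (simp add: sum_mat_index)
  also have "\<dots> = (\<Sum>x\<in>S. mat_trace (F x))"
    by (subst sum.swap, intro sum.cong mat_trace_eq[symmetric] assms) auto
  finally show ?thesis .
qed

lemma eq_mat_if_mult_vec:
  fixes A B :: "'a::comm_ring_1 mat"
  assumes "A \<in> carrier_mat n m" "B \<in> carrier_mat n m"
    and "\<And>v. v \<in> carrier_vec m \<Longrightarrow> A *\<^sub>v v = B *\<^sub>v v"
  shows "A = B"
proof (rule eq_matI)
  fix i j assume ij: "i < dim_row B" "j < dim_col B"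
  have "(A *\<^sub>v unit_vec m j) $ i = (B *\<^sub>v unit_vec m j) $ i" using assms(3) by simp
  then show "A $$ (i, j) = B $$ (i, j)" using assms(1,2) ij by (simp add: scalar_prod_right_unit)
qed (use assms in auto)

text \<open>Taking \<open>B\<close> to be the identity, a scalar matrix or zero gives fixed vectors,
  eigenspaces and kernels, the invariant subspaces to which irreducibility is applied.\<close>

lemma lin_subspace_mult_vec_eq:
  assumes "A \<in> carrier_mat n n" "B \<in> carrier_mat n n"
  shows "lin_subspace n {v \<in> carrier_vec n. A *\<^sub>v v = B *\<^sub>v v}"
  using assms unfolding lin_subspace_def
  by (auto simp: mult_add_distrib_mat_vec[of _ n n] mult_mat_vec[of _ n n] intro!: eq_vecI)

section \<open>Adjoints and transposes\<close>

definition adj :: "complex mat \<Rightarrow> complex mat" where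
  "adj A = transpose_mat (map_mat cnj A)"

lemma adj_carrier: "A \<in> carrier_mat n m \<Longrightarrow> adj A \<in> carrier_mat m n"
  by (simp add: adj_def)

lemma adj_mult:
  assumes "A \<in> carrier_mat n m" "B \<in> carrier_mat m l"
  shows "adj (A * B) = adj B * adj A"
proof (rule eq_matI)
  fix i j assume "i < dim_row (adj B * adj A)" "j < dim_col (adj B * adj A)"
  then have ij: "i < l" "j < n" using assms by (auto simp: adj_def)
  have "adj (A * B) $$ (i, j) = cnj ((A * B) $$ (j, i))"
    using assms ij by (simp add: adj_def del: index_mult_mat(1))
  also have "\<dots> = (adj B * adj A) $$ (i, j)"
    unfolding mult_mat_index[OF assms ij(2,1)]
      mult_mat_index[OF adj_carrier[OF assms(2)] adj_carrier[OF assms(1)] ij]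
    using assms ij by (simp add: adj_def mult.commute)
  finally show "adj (A * B) $$ (i, j) = (adj B * adj A) $$ (i, j)" .
qed (use assms in \<open>auto simp: adj_def\<close>)

lemma mat_trace_adj: "A \<in> carrier_mat n n \<Longrightarrow> mat_trace (adj A) = cnj (mat_trace A)"
  by (auto simp: mat_trace_def adj_def)

lemma mat_trace_transpose: "A \<in> carrier_mat n n \<Longrightarrow> mat_trace (transpose_mat A) = mat_trace A"
  by (auto simp: mat_trace_def)

context group
begin

lemma bij_betw_mult_left: "h \<in> carrier G \<Longrightarrow> bij_betw (\<lambda>g. h \<otimes> g) (carrier G) (carrier G)"
  by (rule bij_betw_byWitness[where f' = "\<lambda>g. inv h \<otimes> g"]) (auto simp: m_assoc[symmetric])

lemma bij_betw_mult_right: "h \<in> carrier G \<Longrightarrow> bij_betw (\<lambda>g. g \<otimes> h) (carrier G) (carrier G)"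
  by (rule bij_betw_byWitness[where f' = "\<lambda>g. g \<otimes> inv h"]) (auto simp: m_assoc)

lemma irreducible_rep_cases:
  assumes "irreducible_representation G n \<rho>" "lin_subspace n W"
    and "\<And>g w. g \<in> carrier G \<Longrightarrow> w \<in> W \<Longrightarrow> \<rho> g *\<^sub>v w \<in> W"
  shows "W = {0\<^sub>v n} \<or> W = carrier_vec n"
  using assms unfolding irreducible_representation_iff by blast

text \<open>The sum \<open>J\<close> of all \<open>\<rho> g\<close> has nonzero trace, so some
  \<open>J u\<close> is nonzero; it is fixed by the group since \<open>\<rho> h * J = J\<close>. The
  fixed vectors thus form a nonzero invariant subspace, hence everything, and an irreducible
  representation with trivial action has degree 1.\<close>

lemma irreducible_sum_nonzero:
  assumes irr: "irreducible_character G \<chi>" and nz: "(\<Sum>g\<in>carrier G. \<chi> g) \<noteq> 0"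
  shows "\<chi> = (\<lambda>g\<in>carrier G. 1)"
proof -
  obtain n \<rho> where ir: "irreducible_representation G n \<rho>" and \<chi>: "\<chi> = afforded_character G \<rho>"
    using irr unfolding irreducible_character_def by blast
  then have rep: "matrix_representation G n \<rho>" by (simp add: irreducible_representation_def)
  define J where "J = sum_mat n \<rho> (carrier G)"
  have J: "J \<in> carrier_mat n n" unfolding J_def by (rule sum_mat_carrier)
  have "mat_trace J = (\<Sum>g\<in>carrier G. \<chi> g)"
    unfolding J_def by (subst mat_trace_sum_mat) (auto simp: rep_carrier[OF rep] \<chi> afforded_character_def)
  then have "J \<noteq> 0\<^sub>m n n" using nz mat_trace_eq[of "0\<^sub>m n n" n] by auto
  moreover have "0\<^sub>m n n *\<^sub>v v = 0\<^sub>v n" if "v \<in> carrier_vec n" for v :: "complex vec"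
    using that by (intro eq_vecI) auto
  ultimately obtain u where u: "u \<in> carrier_vec n" "J *\<^sub>v u \<noteq> 0\<^sub>v n"
    using eq_mat_if_mult_vec[OF J zero_carrier_mat] by metis
  have \<rho>J: "\<rho> h * J = J" if h: "h \<in> carrier G" for h
  proof -
    have "\<rho> h * J = sum_mat n (\<lambda>g. \<rho> (h \<otimes> g)) (carrier G)"
      unfolding J_def using h
      by (subst mult_sum_mat) (auto simp: rep_carrier[OF rep] rep_mult[OF rep] intro!: sum_mat_cong)
    also have "\<dots> = J" unfolding J_def by (rule sum_mat_reindex[OF bij_betw_mult_left[OF h]])
    finally show ?thesis .
  qed
  define W where "W = {v \<in> carrier_vec n. \<forall>g\<in>carrier G. \<rho> g *\<^sub>v v = v}"
  have "lin_subspace n W"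
    using lin_subspace_mult_vec_eq[OF rep_carrier[OF rep] one_carrier_mat]
    unfolding lin_subspace_def W_def by auto
  then have "W = {0\<^sub>v n} \<or> W = carrier_vec n"
    by (rule irreducible_rep_cases[OF ir]) (simp add: W_def)
  moreover have "J *\<^sub>v u \<in> W"
    unfolding W_def using J u
    by (auto simp: assoc_mult_mat_vec[OF rep_carrier[OF rep] J, symmetric] \<rho>J)
  ultimately have W: "W = carrier_vec n" using u by auto
  have \<rho>1: "\<rho> g *\<^sub>v v = v" if "v \<in> carrier_vec n" "g \<in> carrier G" for g v
    using W that unfolding W_def by blast
  have "n = 1"
  proof (rule ccontr)
    assume "n \<noteq> 1"
    then have n: "1 < n" using rep_pos[OF rep] by simp
    \<comment> \<open>The line spanned by the first unit vector: under the trivial action every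
      subspace is invariant, so this one contradicts irreducibility as soon as \<open>n\<close>
      exceeds 1.\<close>
    let ?L = "{v \<in> carrier_vec n. \<forall>i<n. 0 < i \<longrightarrow> v $ i = (0::complex)}"
    have "lin_subspace n ?L" unfolding lin_subspace_def by auto
    then have "?L = {0\<^sub>v n} \<or> ?L = carrier_vec n"
      by (rule irreducible_rep_cases[OF ir]) (use \<rho>1 in auto)
    moreover have "unit_vec n 0 \<in> ?L" using n by auto
    moreover have "unit_vec n 1 \<notin> ?L" using n by auto
    moreover have "unit_vec n 0 \<noteq> (0\<^sub>v n :: complex vec)" using n by simp
    moreover have "unit_vec n 1 \<in> (carrier_vec n :: complex vec set)" by simp
    ultimately show False by blast
  qed
  have "\<rho> g = 1\<^sub>m n" if "g \<in> carrier G" for g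
    using eq_mat_if_mult_vec[OF rep_carrier[OF rep that] one_carrier_mat] \<rho>1 that by simp
  then show ?thesis
    by (auto simp: \<chi> afforded_character_def mat_trace_def \<open>n = 1\<close>)
qed

end

locale fin_group = group G for G (structure) +
  assumes fin: "finite (carrier G)"
begin

lemma order_nonzero: "of_nat (Coset.order G) \<noteq> (0 :: complex)"
  using fin order_gt_0_iff_finite by simp

text \<open>Averaging the standard Hermitian form gives an invariant one, which conjugates
  \<open>\<rho>(g\<inverse>)\<close> into the adjoint of \<open>\<rho> g\<close>.\<close>

lemma mat_trace_rep_inv:
  assumes rep: "matrix_representation G n \<rho>" and h: "h \<in> carrier G"
  shows "mat_trace (\<rho> (inv h)) = cnj (mat_trace (\<rho> h))"
proof -
  note c = rep_carrier[OF rep]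
  define F where "F g = adj (\<rho> g) * \<rho> g" for g
  have Fc: "F g \<in> carrier_mat n n" if "g \<in> carrier G" for g
    unfolding F_def by (rule mult_carrier_mat[OF adj_carrier[OF c[OF that]] c[OF that]])
  define M where "M = sum_mat n F (carrier G)"
  have M: "M \<in> carrier_mat n n" unfolding M_def by (rule sum_mat_carrier)
  have Fh: "adj (\<rho> h) * (F g * \<rho> h) = F (g \<otimes> h)" if g: "g \<in> carrier G" for g
  proof -
    note cc = c[OF g] c[OF h] adj_carrier[OF c[OF g]] adj_carrier[OF c[OF h]]
    show ?thesis unfolding F_def rep_mult[OF rep g h] adj_mult[OF cc(1,2)]
      using cc by (simp add: assoc_mult_mat[of _ n n _ n _ n])
  qed
  have "adj (\<rho> h) * (M * \<rho> h) = sum_mat n (\<lambda>g. F (g \<otimes> h)) (carrier G)"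
  proof -
    have Fhc: "F g * \<rho> h \<in> carrier_mat n n" if "g \<in> carrier G" for g
      by (rule mult_carrier_mat[OF Fc[OF that] c[OF h]])
    have "M * \<rho> h = sum_mat n (\<lambda>g. F g * \<rho> h) (carrier G)"
      unfolding M_def by (rule sum_mat_mult[OF c[OF h]]) (rule Fc)
    then have "adj (\<rho> h) * (M * \<rho> h) = sum_mat n (\<lambda>g. adj (\<rho> h) * (F g * \<rho> h)) (carrier G)"
      using mult_sum_mat[OF adj_carrier[OF c[OF h]], of "carrier G" "\<lambda>g. F g * \<rho> h"] Fhc by simp
    also have "\<dots> = sum_mat n (\<lambda>g. F (g \<otimes> h)) (carrier G)"
      by (rule sum_mat_cong) (rule Fh)
    finally show ?thesis .
  qed
  also have "\<dots> = M" unfolding M_def by (rule sum_mat_reindex[OF bij_betw_mult_right[OF h]])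
  finally have inv: "adj (\<rho> h) * (M * \<rho> h) = M" .
  obtain K where K: "K \<in> carrier_mat n n" "M * K = 1\<^sub>m n" "K * M = 1\<^sub>m n"
  proof (rule trivial_kernel_inverse[OF M])
    fix v :: "complex vec" assume v: "v \<in> carrier_vec n" and Mv: "M *\<^sub>v v = 0\<^sub>v n"
    \<comment> \<open>\<open>w g\<close> is the vector obtained by applying \<open>\<rho> g\<close>
      to \<open>v\<close>. The Hermitian form \<open>M\<close> evaluated at \<open>v\<close> is the
      sum of the squared norms of all \<open>w g\<close>; if \<open>M\<close> kills \<open>v\<close>
      they all vanish, and \<open>w \<one>\<close> is \<open>v\<close> itself.\<close>
    define w where "w g k = (\<Sum>j<n. \<rho> g $$ (k, j) * v $ j)" for g k
    have Mij: "M $$ (i, j) = (\<Sum>g\<in>carrier G. \<Sum>k<n. cnj (\<rho> g $$ (k, i)) * \<rho> g $$ (k, j))"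
      if "i < n" "j < n" for i j
      unfolding M_def sum_mat_index[OF that] F_def
    proof (rule sum.cong)
      fix g assume g: "g \<in> carrier G"
      show "(adj (\<rho> g) * \<rho> g) $$ (i, j) = (\<Sum>k<n. cnj (\<rho> g $$ (k, i)) * \<rho> g $$ (k, j))"
        unfolding mult_mat_index[OF adj_carrier[OF c[OF g]] c[OF g] that]
        using c[OF g] that by (simp add: adj_def)
    qed simp
    have "(\<Sum>g\<in>carrier G. \<Sum>k<n. cnj (w g k) * w g k)
        = (\<Sum>g\<in>carrier G. \<Sum>k<n. \<Sum>i<n. \<Sum>j<n. cnj (v $ i) * (cnj (\<rho> g $$ (k, i)) * \<rho> g $$ (k, j) * v $ j))"
      unfolding w_def cnj_sum sum_product by (intro sum.cong refl) (simp add: mult_ac)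
    also have "\<dots> = (\<Sum>g\<in>carrier G. \<Sum>i<n. \<Sum>k<n. \<Sum>j<n. cnj (v $ i) * (cnj (\<rho> g $$ (k, i)) * \<rho> g $$ (k, j) * v $ j))"
      by (rule sum.cong[OF refl]) (rule sum.swap)
    also have "\<dots> = (\<Sum>i<n. \<Sum>g\<in>carrier G. \<Sum>j<n. \<Sum>k<n. cnj (v $ i) * (cnj (\<rho> g $$ (k, i)) * \<rho> g $$ (k, j) * v $ j))"
      by (rule trans[OF sum.swap]) (rule sum.cong[OF refl], rule sum.cong[OF refl], rule sum.swap)
    also have "\<dots> = (\<Sum>i<n. \<Sum>j<n. \<Sum>g\<in>carrier G. \<Sum>k<n. cnj (v $ i) * (cnj (\<rho> g $$ (k, i)) * \<rho> g $$ (k, j) * v $ j))"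
      by (rule sum.cong[OF refl]) (rule sum.swap)
    also have "\<dots> = (\<Sum>i<n. cnj (v $ i) * (M *\<^sub>v v) $ i)"
      by (intro sum.cong refl)
        (simp add: mult_mat_vec_index[OF M v] Mij sum_distrib_left sum_distrib_right del: index_mult_mat_vec)
    also have "\<dots> = 0" by (simp add: Mv)
    finally have "(\<Sum>g\<in>carrier G. \<Sum>k<n. cnj (w g k) * w g k) = 0" .
    moreover have "cnj z * z = of_real ((cmod z)\<^sup>2)" for z
      using complex_norm_square[of z] by (simp add: mult.commute)
    ultimately have "(\<Sum>g\<in>carrier G. \<Sum>k<n. (cmod (w g k))\<^sup>2) = 0"
      by (metis (mono_tags, lifting) of_real_0 of_real_eq_iff of_real_sum sum.cong)
    then have "\<forall>g\<in>carrier G. (\<Sum>k<n. (cmod (w g k))\<^sup>2) = 0"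
      using fin by (subst (asm) sum_nonneg_eq_0_iff) (auto intro: sum_nonneg)
    then have "\<forall>k<n. w \<one> k = 0"
      by (subst (asm) sum_nonneg_eq_0_iff) auto
    moreover have "w \<one> k = v $ k" if "k < n" for k
    proof -
      have "w \<one> k = (\<Sum>j<n. if k = j then v $ j else 0)"
        unfolding w_def rep_one[OF rep] using that by (intro sum.cong) auto
      then show ?thesis using that by simp
    qed
    ultimately show "v = 0\<^sub>v n" using v by (intro eq_vecI) auto
  qed auto
  have "\<rho> (inv h) \<in> carrier_mat n n" using c h by simp
  note cc = c[OF h] this adj_carrier[OF c[OF h]] M K(1)
  have "adj (\<rho> h) * M = adj (\<rho> h) * (M * (\<rho> h * \<rho> (inv h)))"
    using cc by (simp add: rep_inv[OF rep h])
  also have "\<dots> = adj (\<rho> h) * (M * \<rho> h) * \<rho> (inv h)"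
    using cc by (simp add: assoc_mult_mat[of _ n n _ n _ n])
  also have "\<dots> = M * \<rho> (inv h)" by (simp only: inv)
  finally have eq: "adj (\<rho> h) * M = M * \<rho> (inv h)" .
  have "K * adj (\<rho> h) * M = K * (adj (\<rho> h) * M)" by (rule assoc_mult_mat[OF K(1) cc(3) M])
  also have "\<dots> = K * M * \<rho> (inv h)" unfolding eq by (rule assoc_mult_mat[OF K(1) M cc(2), symmetric])
  also have "\<dots> = \<rho> (inv h)" unfolding K(3) using cc(2) by simp
  finally have "\<rho> (inv h) = K * adj (\<rho> h) * M" ..
  then show ?thesis
    using mat_trace_conj[OF cc(3) M K(1,2)] mat_trace_adj[OF cc(1)] by simp
qed

end

section \<open>Invariant bilinear forms and the Frobenius-Schur indicator\<close>

context group
begin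

text \<open>Multiplying by the transpose of \<open>\<rho> g\<close> turns the condition into the
  usual invariance of the bilinear form with matrix \<open>B\<close>. In the chosen shape it says
  that \<open>B\<close> intertwines \<open>\<rho>\<close> with its dual representation, which is
  what Schur's lemma needs.\<close>

definition invariant_form :: "nat \<Rightarrow> ('a \<Rightarrow> complex mat) \<Rightarrow> complex mat \<Rightarrow> bool" where
  "invariant_form n \<rho> B \<longleftrightarrow> B \<in> carrier_mat n n \<and>
     (\<forall>g\<in>carrier G. B * \<rho> g = transpose_mat (\<rho> (inv g)) * B)"

text \<open>Schur's lemma over the complex numbers: as \<open>n\<close> is positive, the
  characteristic polynomial has a root \<open>c\<close>, and the eigenspace for \<open>c\<close> is
  nonzero and invariant.\<close>

lemma schur_scalar:
  assumes ir: "irreducible_representation G n \<rho>" and A: "A \<in> carrier_mat n n"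
    and comm: "\<And>g. g \<in> carrier G \<Longrightarrow> A * \<rho> g = \<rho> g * A"
  obtains c where "A = c \<cdot>\<^sub>m 1\<^sub>m n"
proof -
  have rep: "matrix_representation G n \<rho>" using ir by (simp add: irreducible_representation_def)
  have "degree (char_poly A) > 0" using degree_monic_char_poly[OF A] rep_pos[OF rep] by simp
  then have "\<not> constant (poly (char_poly A))" by (simp add: constant_degree)
  then obtain c where "poly (char_poly A) c = 0" using fundamental_theorem_of_algebra by blast
  then have "eigenvalue A c" using eigenvalue_root_char_poly[OF A] by simp
  then obtain v where v: "v \<in> carrier_vec n" "v \<noteq> 0\<^sub>v n" "A *\<^sub>v v = c \<cdot>\<^sub>v v"
    using A unfolding eigenvalue_def eigenvector_def by auto
  have cv: "(c \<cdot>\<^sub>m 1\<^sub>m n) *\<^sub>v w = c \<cdot>\<^sub>v w" if "w \<in> carrier_vec n" for w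
    using that by (intro eq_vecI) auto
  let ?W = "{w \<in> carrier_vec n. A *\<^sub>v w = (c \<cdot>\<^sub>m 1\<^sub>m n) *\<^sub>v w}"
  have "lin_subspace n ?W" by (rule lin_subspace_mult_vec_eq) (use A in auto)
  then have "?W = {0\<^sub>v n} \<or> ?W = carrier_vec n"
  proof (rule irreducible_rep_cases[OF ir])
    fix g w assume g: "g \<in> carrier G" and w: "w \<in> ?W"
    note c = rep_carrier[OF rep g]
    have wc: "w \<in> carrier_vec n" using w by blast
    have "A *\<^sub>v (\<rho> g *\<^sub>v w) = \<rho> g *\<^sub>v (A *\<^sub>v w)"
      unfolding assoc_mult_mat_vec[OF A c wc, symmetric] comm[OF g]
      by (rule assoc_mult_mat_vec[OF c A wc])
    also have "\<dots> = c \<cdot>\<^sub>v (\<rho> g *\<^sub>v w)" using w wc cv c by (simp add: mult_mat_vec[of _ n n])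
    finally show "\<rho> g *\<^sub>v w \<in> ?W" using cv c wc by auto
  qed
  moreover have "v \<in> ?W" using v cv by simp
  ultimately have "?W = carrier_vec n" using v(2) by blast
  then have "A = c \<cdot>\<^sub>m 1\<^sub>m n" by (intro eq_mat_if_mult_vec[OF A]) (simp, blast)
  then show ?thesis by (rule that)
qed

text \<open>The kernel of an intertwiner is invariant, and it is not the whole space because
  \<open>B\<close> is nonzero.\<close>

lemma invariant_form_inverse:
  assumes ir: "irreducible_representation G n \<rho>" and B: "invariant_form n \<rho> B" and "B \<noteq> 0\<^sub>m n n"
  obtains C where "C \<in> carrier_mat n n" "B * C = 1\<^sub>m n" "C * B = 1\<^sub>m n"
proof -
  have rep: "matrix_representation G n \<rho>" using ir by (simp add: irreducible_representation_def)
  have Bc: "B \<in> carrier_mat n n" using B by (simp add: invariant_form_def)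
  have z: "0\<^sub>m n n *\<^sub>v w = 0\<^sub>v n" if "w \<in> carrier_vec n" for w :: "complex vec"
    using that by (intro eq_vecI) auto
  let ?W = "{w \<in> carrier_vec n. B *\<^sub>v w = 0\<^sub>m n n *\<^sub>v w}"
  have "lin_subspace n ?W" by (rule lin_subspace_mult_vec_eq) (use Bc in auto)
  then have W: "?W = {0\<^sub>v n} \<or> ?W = carrier_vec n"
  proof (rule irreducible_rep_cases[OF ir])
    fix g w assume g: "g \<in> carrier G" and w: "w \<in> ?W"
    have wc: "w \<in> carrier_vec n" and Bw: "B *\<^sub>v w = 0\<^sub>v n" using w z by auto
    have t: "transpose_mat (\<rho> (inv g)) \<in> carrier_mat n n" using rep_carrier[OF rep] g by simp
    have "B *\<^sub>v (\<rho> g *\<^sub>v w) = transpose_mat (\<rho> (inv g)) *\<^sub>v (B *\<^sub>v w)"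
      using B g unfolding invariant_form_def
      by (metis assoc_mult_mat_vec[OF Bc rep_carrier[OF rep g] wc] assoc_mult_mat_vec[OF t Bc wc])
    also have "\<dots> = 0\<^sub>v n" unfolding Bw using t by (intro eq_vecI) auto
    finally show "\<rho> g *\<^sub>v w \<in> ?W" using z rep_carrier[OF rep g] wc by auto
  qed
  have "?W \<noteq> carrier_vec n"
    using eq_mat_if_mult_vec[OF Bc zero_carrier_mat] assms(3) by blast
  then have "?W = {0\<^sub>v n}" using W by blast
  then show ?thesis
    using z by (intro trivial_kernel_inverse[OF Bc _ that]) auto
qed

text \<open>With \<open>C\<close> the inverse of \<open>B\<close>, the product \<open>C * A\<close>
  goes to the dual and back, so it commutes with \<open>\<rho>\<close> and is a scalar.\<close>

lemma invariant_form_unique: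
  assumes ir: "irreducible_representation G n \<rho>" and B: "invariant_form n \<rho> B" "B \<noteq> 0\<^sub>m n n"
    and A: "invariant_form n \<rho> A"
  obtains c where "A = c \<cdot>\<^sub>m B"
proof -
  have rep: "matrix_representation G n \<rho>" using ir by (simp add: irreducible_representation_def)
  obtain C where C: "C \<in> carrier_mat n n" "B * C = 1\<^sub>m n" "C * B = 1\<^sub>m n"
    by (rule invariant_form_inverse[OF ir B]) (rule that)
  have Bc: "B \<in> carrier_mat n n" and Ac: "A \<in> carrier_mat n n"
    using A B by (auto simp: invariant_form_def)
  have comm: "C * A * \<rho> g = \<rho> g * (C * A)" if g: "g \<in> carrier G" for g
  proof -
    let ?t = "transpose_mat (\<rho> (inv g))"
    have c: "\<rho> g \<in> carrier_mat n n" "?t \<in> carrier_mat n n" using rep_carrier[OF rep] g by auto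
    have "C * ?t = C * ?t * (B * C)" using C c by simp
    also have "\<dots> = C * (?t * B) * C"
      using C(1) c Bc by (simp add: assoc_mult_mat[of _ n n _ n _ n])
    also have "?t * B = B * \<rho> g" using B g by (simp add: invariant_form_def)
    also have "C * (B * \<rho> g) * C = C * B * \<rho> g * C"
      using C(1) c Bc by (simp add: assoc_mult_mat[of _ n n _ n _ n])
    also have "\<dots> = \<rho> g * C" using C c by simp
    finally have Ct: "C * ?t = \<rho> g * C" .
    have "C * A * \<rho> g = C * (A * \<rho> g)"
      using C(1) c Ac by (simp add: assoc_mult_mat[of _ n n _ n _ n])
    also have "A * \<rho> g = ?t * A" using A g by (simp add: invariant_form_def)
    also have "C * (?t * A) = C * ?t * A"
      using C(1) c Ac by (simp add: assoc_mult_mat[of _ n n _ n _ n])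
    also have "\<dots> = \<rho> g * (C * A)" unfolding Ct
      using C(1) c Ac by (simp add: assoc_mult_mat[of _ n n _ n _ n])
    finally show ?thesis .
  qed
  obtain c where c: "C * A = c \<cdot>\<^sub>m 1\<^sub>m n"
    by (rule schur_scalar[OF ir _ comm]) (use C Ac that in auto)
  have "A = B * C * A" using C Ac by simp
  also have "\<dots> = B * (C * A)" using C(1) Ac Bc by (simp add: assoc_mult_mat[of _ n n _ n _ n])
  also have "\<dots> = c \<cdot>\<^sub>m B" unfolding c using Bc by (simp add: mult_smult_distrib[of _ n n _ n])
  finally show ?thesis by (rule that)
qed

lemma invariant_form_transpose:
  assumes rep: "matrix_representation G n \<rho>" and B: "invariant_form n \<rho> B"
  shows "invariant_form n \<rho> (transpose_mat B)"
  unfolding invariant_form_def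
proof (intro conjI ballI)
  have Bc: "B \<in> carrier_mat n n" using B by (simp add: invariant_form_def)
  then show "transpose_mat B \<in> carrier_mat n n" by simp
  fix g assume g: "g \<in> carrier G"
  note c = rep_carrier[OF rep g] rep_carrier[OF rep inv_closed[OF g]]
  have "B * \<rho> (inv g) = transpose_mat (\<rho> g) * B"
    using B g unfolding invariant_form_def by (metis inv_closed inv_inv)
  then have "transpose_mat (transpose_mat (\<rho> g) * B) = transpose_mat (B * \<rho> (inv g))" by simp
  then show "transpose_mat B * \<rho> g = transpose_mat (\<rho> (inv g)) * transpose_mat B"
    using c Bc by (simp add: transpose_mult[of _ n n _ n])
qed

text \<open>A nonzero invariant form is an isomorphism with the dual representation, whose character
  at \<open>g\<close> is the trace of \<open>\<rho> (inv g)\<close>.\<close>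

lemma invariant_form_real:
  assumes ir: "irreducible_representation G n \<rho>" and B: "invariant_form n \<rho> B" "B \<noteq> 0\<^sub>m n n"
    and g: "g \<in> carrier G"
  shows "mat_trace (\<rho> (inv g)) = mat_trace (\<rho> g)"
proof -
  have rep: "matrix_representation G n \<rho>" using ir by (simp add: irreducible_representation_def)
  obtain C where C: "C \<in> carrier_mat n n" "B * C = 1\<^sub>m n" "C * B = 1\<^sub>m n"
    by (rule invariant_form_inverse[OF ir B]) (rule that)
  have Bc: "B \<in> carrier_mat n n" using B by (simp add: invariant_form_def)
  note c = rep_carrier[OF rep g] rep_carrier[OF rep inv_closed[OF g]]
  have "C * transpose_mat (\<rho> (inv g)) * B = C * (B * \<rho> g)"
    using B g C(1) Bc c by (simp add: invariant_form_def assoc_mult_mat[of _ n n _ n _ n])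
  also have "\<dots> = \<rho> g" using C Bc c by (simp flip: assoc_mult_mat[of _ n n _ n _ n])
  finally have "mat_trace (\<rho> g) = mat_trace (transpose_mat (\<rho> (inv g)))"
    using mat_trace_conj[OF _ Bc C(1,2), of "transpose_mat (\<rho> (inv g))"] c by simp
  then show ?thesis using mat_trace_transpose c by simp
qed

text \<open>The sum is not divided by the group order; the factor reappears when an already
  invariant form is averaged.\<close>

definition form_average :: "nat \<Rightarrow> ('a \<Rightarrow> complex mat) \<Rightarrow> complex mat \<Rightarrow> complex mat" where
  "form_average n \<rho> X = sum_mat n (\<lambda>g. transpose_mat (\<rho> g) * (X * \<rho> g)) (carrier G)"

lemma invariant_form_average:
  assumes rep: "matrix_representation G n \<rho>" and X: "X \<in> carrier_mat n n"
  shows "invariant_form n \<rho> (form_average n \<rho> X)"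
  unfolding invariant_form_def
proof (intro conjI ballI)
  show "form_average n \<rho> X \<in> carrier_mat n n" by (simp add: form_average_def sum_mat_carrier)
  fix h assume h: "h \<in> carrier G"
  note c = rep_carrier[OF rep]
  let ?F = "\<lambda>g. transpose_mat (\<rho> g) * (X * \<rho> g)"
  have Fc: "?F g \<in> carrier_mat n n" if "g \<in> carrier G" for g using c[OF that] X by auto
  have hc: "\<rho> h \<in> carrier_mat n n" "transpose_mat (\<rho> (inv h)) \<in> carrier_mat n n"
    using c h by auto
  \<comment> \<open>Writing \<open>g\<close> as \<open>(g \<otimes> h) \<otimes> inv h\<close>
    expresses the summand at \<open>g\<close>, multiplied by \<open>\<rho> h\<close>, through the
    summand at \<open>g \<otimes> h\<close>; reindexing by right multiplication then gives
    invariance.\<close>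
  have F: "transpose_mat (\<rho> (inv h)) * ?F (g \<otimes> h) = ?F g * \<rho> h" if g: "g \<in> carrier G" for g
  proof -
    have eq: "\<rho> g = \<rho> (g \<otimes> h) * \<rho> (inv h)"
      using g h by (simp flip: rep_mult[OF rep] add: m_assoc)
    have gc: "\<rho> g \<in> carrier_mat n n" "\<rho> (g \<otimes> h) \<in> carrier_mat n n" "\<rho> (inv h) \<in> carrier_mat n n"
      using c g h by auto
    have "transpose_mat (\<rho> g) = transpose_mat (\<rho> (inv h)) * transpose_mat (\<rho> (g \<otimes> h))"
      by (subst eq) (rule transpose_mult[OF gc(2,3)])
    then have "?F g * \<rho> h =
        transpose_mat (\<rho> (inv h)) * (transpose_mat (\<rho> (g \<otimes> h)) * (X * (\<rho> g * \<rho> h)))"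
      using gc hc X by (simp add: assoc_mult_mat[of _ n n _ n _ n])
    then show ?thesis by (simp only: rep_mult[OF rep g h])
  qed
  have "form_average n \<rho> X * \<rho> h = sum_mat n (\<lambda>g. ?F g * \<rho> h) (carrier G)"
    unfolding form_average_def by (rule sum_mat_mult[OF hc(1) Fc])
  also have "\<dots> = sum_mat n (\<lambda>g. transpose_mat (\<rho> (inv h)) * ?F (g \<otimes> h)) (carrier G)"
    by (rule sum_mat_cong) (simp only: F)
  also have "\<dots> = sum_mat n (\<lambda>g. transpose_mat (\<rho> (inv h)) * ?F g) (carrier G)"
    by (rule sum_mat_reindex[OF bij_betw_mult_right[OF h]])
  also have "\<dots> = transpose_mat (\<rho> (inv h)) * form_average n \<rho> X"
    unfolding form_average_def by (rule mult_sum_mat[OF hc(2) Fc, symmetric])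
  finally show "form_average n \<rho> X * \<rho> h = transpose_mat (\<rho> (inv h)) * form_average n \<rho> X" .
qed

lemma form_average_index:
  assumes rep: "matrix_representation G n \<rho>" and X: "X \<in> carrier_mat n n" and kl: "k < n" "l < n"
  shows "form_average n \<rho> X $$ (k, l) =
    (\<Sum>g\<in>carrier G. \<Sum>a<n. \<Sum>b<n. X $$ (a, b) * (\<rho> g $$ (a, k) * \<rho> g $$ (b, l)))"
  unfolding form_average_def sum_mat_index[OF kl]
proof (rule sum.cong)
  fix g assume g: "g \<in> carrier G"
  note c = rep_carrier[OF rep g]
  have "(transpose_mat (\<rho> g) * (X * \<rho> g)) $$ (k, l) = (\<Sum>a<n. \<rho> g $$ (a, k) * (X * \<rho> g) $$ (a, l))"
    using c X kl by (subst mult_mat_index[of _ n n _ n]) (auto simp del: index_mult_mat(1))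
  also have "\<dots> = (\<Sum>a<n. \<Sum>b<n. X $$ (a, b) * (\<rho> g $$ (a, k) * \<rho> g $$ (b, l)))"
    using mult_mat_index[OF X c _ kl(2)]
    by (auto simp: sum_distrib_left mult_ac simp del: index_mult_mat(1) intro!: sum.cong)
  finally show "(transpose_mat (\<rho> g) * (X * \<rho> g)) $$ (k, l) =
    (\<Sum>a<n. \<Sum>b<n. X $$ (a, b) * (\<rho> g $$ (a, k) * \<rho> g $$ (b, l)))" .
qed simp

end

context fin_group
begin

lemma form_average_invariant:
  assumes rep: "matrix_representation G n \<rho>" and B: "invariant_form n \<rho> B"
  shows "form_average n \<rho> B = of_nat (Coset.order G) \<cdot>\<^sub>m B"
proof -
  have Bc: "B \<in> carrier_mat n n" using B by (simp add: invariant_form_def)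
  have "transpose_mat (\<rho> g) * (B * \<rho> g) = B" if g: "g \<in> carrier G" for g
  proof -
    note c = rep_carrier[OF rep g] rep_carrier[OF rep inv_closed[OF g]]
    have "transpose_mat (\<rho> g) * (B * \<rho> g) = transpose_mat (\<rho> g) * (transpose_mat (\<rho> (inv g)) * B)"
      using B g by (simp add: invariant_form_def)
    also have "\<dots> = transpose_mat (\<rho> (inv g) * \<rho> g) * B"
      using c Bc by (simp add: transpose_mult[of _ n n _ n] assoc_mult_mat[of _ n n _ n _ n])
    also have "\<dots> = B" using Bc by (simp add: rep_inv[OF rep g])
    finally show ?thesis .
  qed
  then have "form_average n \<rho> B = sum_mat n (\<lambda>_. B) (carrier G)"
    unfolding form_average_def by (intro sum_mat_cong)
  also have "\<dots> = of_nat (Coset.order G) \<cdot>\<^sub>m B"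
    using Bc by (intro eq_matI) (auto simp: sum_mat_def Coset.order_def)
  finally show ?thesis .
qed

text \<open>The forms averaged from the matrix units are multiples \<open>f a b\<close> of the essentially unique
  invariant form \<open>B\<close>, and \<open>B\<close> is symmetric or alternating; evaluating the average of \<open>B\<close> itself
  and comparing with \<open>\<Sum>g. \<chi>(g\<^sup>2)\<close> identifies the indicator with the sign of \<open>B\<close>.\<close>

lemma frobenius_schur_trichotomy:
  assumes irr: "irreducible_character G \<chi>"
  shows "frobenius_schur_indicator G \<chi> \<in> {0, 1, -1}"
    and "frobenius_schur_indicator G \<chi> \<noteq> 0 \<Longrightarrow> real_valued G \<chi>"
proof -
  let ?N = "of_nat (Coset.order G) :: complex"
  obtain n \<rho> where ir: "irreducible_representation G n \<rho>" and \<chi>: "\<chi> = afforded_character G \<rho>"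
    using irr unfolding irreducible_character_def by blast
  then have rep: "matrix_representation G n \<rho>" by (simp add: irreducible_representation_def)
  define E where "E a b = mat n n (\<lambda>(c, d). if c = a \<and> d = b then 1 else (0 :: complex))" for a b
  define t where "t a b = form_average n \<rho> (E a b)" for a b
  have Ec: "E a b \<in> carrier_mat n n" for a b by (simp add: E_def)
  have tinv: "invariant_form n \<rho> (t a b)" for a b
    unfolding t_def by (rule invariant_form_average[OF rep Ec])
  have tidx: "t a b $$ (k, l) = (\<Sum>g\<in>carrier G. \<rho> g $$ (a, k) * \<rho> g $$ (b, l))"
    if "a < n" "b < n" "k < n" "l < n" for a b k l
  proof -
    have "(\<Sum>c<n. \<Sum>d<n. E a b $$ (c, d) * (\<rho> g $$ (c, k) * \<rho> g $$ (d, l)))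
        = \<rho> g $$ (a, k) * \<rho> g $$ (b, l)" for g
    proof -
      have "(\<Sum>c<n. \<Sum>d<n. E a b $$ (c, d) * (\<rho> g $$ (c, k) * \<rho> g $$ (d, l)))
        = (\<Sum>c<n. \<Sum>d<n. if d = b then (if c = a then \<rho> g $$ (a, k) * \<rho> g $$ (b, l) else 0) else 0)"
        by (intro sum.cong refl) (auto simp: E_def)
      then show ?thesis using that by simp
    qed
    then show ?thesis
      unfolding t_def form_average_index[OF rep Ec that(3,4)] using that by simp
  qed
  \<comment> \<open>The trace of the square of \<open>\<rho> g\<close> is the sum of the products of
    its \<open>(a, b)\<close> and \<open>(b, a)\<close> entries. By \<open>tidx\<close> the sum over
    \<open>g\<close> of such a product is the \<open>(b, a)\<close> entry of
    \<open>t a b\<close>.\<close>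
  have nu: "(\<Sum>g\<in>carrier G. \<chi> (g [^] (2::nat))) = (\<Sum>a<n. \<Sum>b<n. t a b $$ (b, a))"
  proof -
    have "\<chi> (g [^] (2::nat)) = (\<Sum>a<n. \<Sum>b<n. \<rho> g $$ (a, b) * \<rho> g $$ (b, a))"
      if g: "g \<in> carrier G" for g
    proof -
      have "\<chi> (g [^] (2::nat)) = mat_trace (\<rho> g * \<rho> g)"
        using g by (simp add: \<chi> afforded_character_def numeral_2_eq_2 rep_mult[OF rep])
      also have "\<dots> = (\<Sum>a<n. (\<rho> g * \<rho> g) $$ (a, a))"
        using rep_carrier[OF rep g] by (intro mat_trace_eq) auto
      finally show ?thesis
        using mult_mat_index[OF rep_carrier[OF rep g] rep_carrier[OF rep g]] by simp
    qed
    then have "(\<Sum>g\<in>carrier G. \<chi> (g [^] (2::nat)))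
        = (\<Sum>g\<in>carrier G. \<Sum>a<n. \<Sum>b<n. \<rho> g $$ (a, b) * \<rho> g $$ (b, a))" by simp
    also have "\<dots> = (\<Sum>a<n. \<Sum>g\<in>carrier G. \<Sum>b<n. \<rho> g $$ (a, b) * \<rho> g $$ (b, a))"
      by (rule sum.swap)
    also have "\<dots> = (\<Sum>a<n. \<Sum>b<n. \<Sum>g\<in>carrier G. \<rho> g $$ (a, b) * \<rho> g $$ (b, a))"
      by (intro sum.cong refl sum.swap)
    finally show ?thesis by (simp add: tidx)
  qed
  have "frobenius_schur_indicator G \<chi> \<in> {0, 1, -1} \<and>
      (frobenius_schur_indicator G \<chi> \<noteq> 0 \<longrightarrow> real_valued G \<chi>)"
  \<comment> \<open>If all averaged matrix units vanish, so does every term in \<open>nu\<close> and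
    the indicator is 0; otherwise one of them serves as \<open>B\<close>.\<close>
  proof (cases "\<forall>a<n. \<forall>b<n. t a b = 0\<^sub>m n n")
    case True
    then show ?thesis by (simp add: frobenius_schur_indicator_def nu)
  next
    case False
    then obtain B where B: "invariant_form n \<rho> B" "B \<noteq> 0\<^sub>m n n" using tinv by blast
    have Bc: "B \<in> carrier_mat n n" using B by (simp add: invariant_form_def)
    have "\<exists>c. t a b = c \<cdot>\<^sub>m B" for a b
      using invariant_form_unique[OF ir B tinv] by metis
    then obtain f where f: "\<And>a b. t a b = f a b \<cdot>\<^sub>m B" by metis
    obtain \<epsilon> where \<epsilon>: "transpose_mat B = \<epsilon> \<cdot>\<^sub>m B"
      using invariant_form_unique[OF ir B invariant_form_transpose[OF rep B(1)]] by metis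
    have sym: "B $$ (l, k) = \<epsilon> * B $$ (k, l)" if "k < n" "l < n" for k l
    proof -
      have "B $$ (l, k) = transpose_mat B $$ (k, l)" using Bc that by simp
      then show ?thesis unfolding \<epsilon> using Bc that by simp
    qed
    have "B = 0\<^sub>m n n" if "\<forall>k<n. \<forall>l<n. B $$ (k, l) = 0"
      using that Bc by (intro eq_matI) auto
    then obtain k l where kl: "k < n" "l < n" "B $$ (k, l) \<noteq> 0" using B(2) by blast
    have "B $$ (k, l) = \<epsilon> * \<epsilon> * B $$ (k, l)" using sym[OF kl(1,2)] sym[OF kl(2,1)] by simp
    then have "\<epsilon> * \<epsilon> = 1" using kl(3) by simp
    then have \<epsilon>1: "\<epsilon> \<in> {1, -1}" by (simp add: square_eq_1_iff)
    \<comment> \<open>The entry \<open>(k, l)\<close> of \<open>B\<close> is nonzero and can be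
      cancelled, which leaves the normalisation of the coefficients \<open>f a b\<close> in
      \<open>N\<close>.\<close>
    have "?N * B $$ (k, l) = form_average n \<rho> B $$ (k, l)"
      using form_average_invariant[OF rep B(1)] Bc kl by simp
    also have "\<dots> = (\<Sum>g\<in>carrier G. \<Sum>a<n. \<Sum>b<n. B $$ (a, b) * (\<rho> g $$ (a, k) * \<rho> g $$ (b, l)))"
      by (rule form_average_index[OF rep Bc kl(1,2)])
    also have "\<dots> = (\<Sum>a<n. \<Sum>g\<in>carrier G. \<Sum>b<n. B $$ (a, b) * (\<rho> g $$ (a, k) * \<rho> g $$ (b, l)))"
      by (rule sum.swap)
    also have "\<dots> = (\<Sum>a<n. \<Sum>b<n. \<Sum>g\<in>carrier G. B $$ (a, b) * (\<rho> g $$ (a, k) * \<rho> g $$ (b, l)))"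
      by (intro sum.cong refl sum.swap)
    also have "\<dots> = (\<Sum>a<n. \<Sum>b<n. B $$ (a, b) * t a b $$ (k, l))"
      using kl by (simp add: tidx sum_distrib_left)
    also have "\<dots> = (\<Sum>a<n. \<Sum>b<n. B $$ (a, b) * f a b) * B $$ (k, l)"
      using Bc kl by (simp add: f sum_distrib_right mult.assoc)
    finally have N: "(\<Sum>a<n. \<Sum>b<n. B $$ (a, b) * f a b) = ?N" using kl(3) by simp
    have "(\<Sum>g\<in>carrier G. \<chi> (g [^] (2::nat))) = (\<Sum>a<n. \<Sum>b<n. \<epsilon> * (B $$ (a, b) * f a b))"
      unfolding nu
    proof (intro sum.cong refl)
      fix a b assume ab: "a \<in> {..<n}" "b \<in> {..<n}"
      then have "t a b $$ (b, a) = f a b * B $$ (b, a)" using Bc by (simp add: f)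
      also have "B $$ (b, a) = \<epsilon> * B $$ (a, b)" using ab by (intro sym) auto
      finally show "t a b $$ (b, a) = \<epsilon> * (B $$ (a, b) * f a b)" by simp
    qed
    also have "\<dots> = \<epsilon> * ?N" unfolding N[symmetric] by (simp add: sum_distrib_left)
    finally have "frobenius_schur_indicator G \<chi> = \<epsilon>"
      using order_nonzero by (simp add: frobenius_schur_indicator_def)
    moreover have "real_valued G \<chi>"
      unfolding real_valued_def
    proof
      fix g assume g: "g \<in> carrier G"
      have "cnj (\<chi> g) = \<chi> g"
        using mat_trace_rep_inv[OF rep g] invariant_form_real[OF ir B g] g
        by (simp add: \<chi> afforded_character_def)
      then show "\<chi> g \<in> \<real>" by (metis Reals_cnj_iff)
    qed
    ultimately show ?thesis using \<epsilon>1 by auto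
  qed
  then show "frobenius_schur_indicator G \<chi> \<in> {0, 1, -1}"
    and "frobenius_schur_indicator G \<chi> \<noteq> 0 \<Longrightarrow> real_valued G \<chi>" by auto
qed

end

section \<open>The permutation character\<close>

context fin_group
begin

text \<open>The fibres of the map from \<open>g\<close> to \<open>K #> g\<close> are the cosets
  themselves, all of size \<open>card K\<close>.\<close>

lemma sum_rcosets:
  fixes F :: "'a set \<Rightarrow> complex"
  assumes K: "subgroup K G"
  shows "(\<Sum>g\<in>carrier G. F (K #> g)) = of_nat (card K) * (\<Sum>C\<in>rcosets K. F C)"
proof -
  have KG: "K \<subseteq> carrier G" by (rule subgroup.subset[OF K])
  have fib: "{g \<in> carrier G. K #> g = C} = C" if C: "C \<in> rcosets K" for C
  proof -
    obtain x where x: "x \<in> carrier G" "C = K #> x" using C by (auto simp: RCOSETS_def)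
    then have "C \<subseteq> carrier G" using r_coset_subset_G[OF KG] by simp
    moreover have "K #> g = C" if "g \<in> C" for g
      using repr_independence[OF _ x(1) K, of g] that x(2) by simp
    moreover have "g \<in> C" if "g \<in> carrier G" "K #> g = C" for g
      using rcos_self[OF that(1) K] that(2) by simp
    ultimately show ?thesis by blast
  qed
  have finC: "finite (rcosets K)" using fin rcosets_subset_PowG[OF K] by (simp add: finite_subset)
  have "(\<Sum>g\<in>carrier G. F (K #> g)) = (\<Sum>C\<in>rcosets K. \<Sum>g\<in>{g \<in> carrier G. K #> g = C}. F (K #> g))"
    by (rule sum.group[symmetric]) (auto simp: fin finC RCOSETS_def)
  also have "\<dots> = (\<Sum>C\<in>rcosets K. of_nat (card {g \<in> carrier G. K #> g = C}) * F C)"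
    by (intro sum.cong refl) simp
  also have "\<dots> = (\<Sum>C\<in>rcosets K. of_nat (card K) * F C)"
    using card_rcosets_equal[OF _ KG] by (intro sum.cong refl) (simp add: fib)
  finally show ?thesis by (simp add: sum_distrib_left)
qed

lemma inv_mult_cancel: "x \<in> carrier G \<Longrightarrow> y \<in> carrier G \<Longrightarrow> inv x \<otimes> (x \<otimes> y) = y"
  by (simp flip: m_assoc)

lemma mult_inv_cancel: "x \<in> carrier G \<Longrightarrow> y \<in> carrier G \<Longrightarrow> x \<otimes> (inv x \<otimes> y) = y"
  by (simp flip: m_assoc)

lemma conj_pow:
  assumes "x \<in> carrier G" "g \<in> carrier G"
  shows "(x \<otimes> g \<otimes> inv x) [^] (k::nat) = x \<otimes> g [^] k \<otimes> inv x"
proof (induction k)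
  case (Suc k)
  then show ?case using assms by (simp add: m_assoc inv_mult_cancel)
qed (use assms in simp)

lemma bij_betw_conj: "x \<in> carrier G \<Longrightarrow> bij_betw (\<lambda>g. x \<otimes> g \<otimes> inv x) (carrier G) (carrier G)"
  using bij_betw_trans[OF bij_betw_mult_left bij_betw_mult_right, of x "inv x"] by (simp add: comp_def)

abbreviation perm_char :: "'a set \<Rightarrow> 'a \<Rightarrow> complex" where
  "perm_char H \<equiv> induced_character G H (principal_character H)"

lemma perm_char_eq:
  "g \<in> carrier G \<Longrightarrow>
    perm_char H g = (\<Sum>x\<in>carrier G. if x \<otimes> g \<otimes> inv x \<in> H then 1 else 0) / of_nat (card H)"
  by (auto simp: induced_character_def principal_character_def intro!: sum.cong arg_cong2[where f = "(/)"])

lemma card_subgroup_nonzero: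
  assumes "subgroup H G" shows "of_nat (card H) \<noteq> (0::complex)"
  using assms fin by (metis card_gt_0_iff finite_subset of_nat_eq_0_iff rel_simps(70) subgroup.one_closed
      subgroup.subset empty_iff)

text \<open>The group acts on the right cosets by right multiplication. With rows indexed by the
  source coset, the permutation matrices of this right action multiply in the right order. The coset
  of \<open>x\<close> is fixed by \<open>g\<close> exactly if
  \<open>x \<otimes> g \<otimes> inv x\<close> lies in \<open>H\<close>, so the trace is the induced
  character.\<close>

lemma perm_char_afforded:
  assumes H: "subgroup H G"
  obtains n \<rho> where "matrix_representation G n \<rho>"
    "\<And>g. g \<in> carrier G \<Longrightarrow> mat_trace (\<rho> g) = perm_char H g"
proof -
  define r where "r g C D = (if C #> g = D then 1 else 0 :: complex)" for g and C D :: "'a set"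
  have HG: "H \<subseteq> carrier G" by (rule subgroup.subset[OF H])
  have finC: "finite (rcosets H)" using fin rcosets_subset_PowG[OF H] by (simp add: finite_subset)
  have sub: "C \<subseteq> carrier G" if "C \<in> rcosets H" for C using that rcosets_subset_PowG[OF H] by auto
  have act: "C #> g \<in> rcosets H" if "C \<in> rcosets H" "g \<in> carrier G" for C g
    using that HG by (auto simp: RCOSETS_def coset_mult_assoc)
  obtain \<rho> where \<rho>: "matrix_representation G (card (rcosets H)) \<rho>"
    "\<And>g. g \<in> carrier G \<Longrightarrow> mat_trace (\<rho> g) = (\<Sum>C\<in>rcosets H. r g C C)"
  proof (rule representation_indexed[of "rcosets H" r])
    show "rcosets H \<noteq> {}" by (auto simp: RCOSETS_def)
    fix g h C D assume *: "g \<in> carrier G" "h \<in> carrier G" "C \<in> rcosets H" "D \<in> rcosets H"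
    have "(\<Sum>E\<in>rcosets H. r g C E * r h E D) = (\<Sum>E\<in>rcosets H. if C #> g = E then r h E D else 0)"
      by (intro sum.cong) (auto simp: r_def)
    also have "\<dots> = r h (C #> g) D" using finC act * by simp
    also have "\<dots> = r (g \<otimes> h) C D" using * sub by (simp add: r_def coset_mult_assoc)
    finally show "r (g \<otimes> h) C D = (\<Sum>E\<in>rcosets H. r g C E * r h E D)" ..
  next
    fix C D assume "C \<in> rcosets H" "D \<in> rcosets H"
    then show "r \<one> C D = (if C = D then 1 else 0)" using sub by (simp add: r_def)
  qed (use finC in auto)
  have "mat_trace (\<rho> g) = perm_char H g" if g: "g \<in> carrier G" for g
  proof -
    have "x \<otimes> g \<otimes> inv x \<in> H \<longleftrightarrow> H #> x #> g = H #> x" if x: "x \<in> carrier G" for x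
    proof -
      have "H #> x #> g = H #> x \<longleftrightarrow> H #> (x \<otimes> g) = H #> x" using HG g x by (simp add: coset_mult_assoc)
      also have "\<dots> \<longleftrightarrow> H #> (x \<otimes> g \<otimes> inv x) = H"
        using HG g x by (metis coset_mult_inv1 coset_mult_inv2 m_closed)
      also have "\<dots> \<longleftrightarrow> x \<otimes> g \<otimes> inv x \<in> H"
        using coset_join1[OF _ _ H] coset_join2[OF _ H] g x by auto
      finally show ?thesis ..
    qed
    then have "(\<Sum>x\<in>carrier G. if x \<otimes> g \<otimes> inv x \<in> H then 1 else 0) = (\<Sum>x\<in>carrier G. r g (H #> x) (H #> x))"
      by (intro sum.cong) (auto simp: r_def)
    also have "\<dots> = of_nat (card H) * mat_trace (\<rho> g)"
      unfolding \<rho>(2)[OF g] by (rule sum_rcosets[OF H])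
    finally show ?thesis using card_subgroup_nonzero[OF H] by (simp add: perm_char_eq[OF g])
  qed
  with \<rho>(1) that show ?thesis by blast
qed

text \<open>After exchanging the two sums, conjugation by each \<open>x\<close> permutes the group
  and commutes with powers, so all inner sums agree. The case \<open>k = 1\<close> yields the
  multiplicity of the principal character, the case \<open>k = 2\<close> the sum of the
  indicators.\<close>

lemma sum_perm_char_pow:
  assumes H: "subgroup H G"
  shows "(\<Sum>g\<in>carrier G. perm_char H (g [^] (k::nat)))
    = of_nat (Coset.order G) * of_nat (card {g \<in> carrier G. g [^] k \<in> H}) / of_nat (card H)"
proof -
  let ?f = "\<lambda>g. if g [^] k \<in> H then 1 else 0 :: complex"
  have "(\<Sum>g\<in>carrier G. perm_char H (g [^] k))
      = (\<Sum>g\<in>carrier G. \<Sum>x\<in>carrier G. ?f (x \<otimes> g \<otimes> inv x)) / of_nat (card H)"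
    by (simp add: perm_char_eq conj_pow sum_divide_distrib)
  also have "(\<Sum>g\<in>carrier G. \<Sum>x\<in>carrier G. ?f (x \<otimes> g \<otimes> inv x))
      = (\<Sum>x\<in>carrier G. \<Sum>g\<in>carrier G. ?f (x \<otimes> g \<otimes> inv x))"
    by (rule sum.swap)
  also have "\<dots> = (\<Sum>x\<in>carrier G. \<Sum>g\<in>carrier G. ?f g)"
    by (intro sum.cong refl sum.reindex_bij_betw[OF bij_betw_conj])
  also have "(\<Sum>g\<in>carrier G. ?f g) = of_nat (card {g \<in> carrier G. g [^] k \<in> H})"
    using fin by (simp add: sum.If_cases Int_def)
  finally show ?thesis by (simp add: Coset.order_def)
qed

lemma sum_perm_char:
  assumes H: "subgroup H G"
  shows "(\<Sum>g\<in>carrier G. perm_char H g) = of_nat (Coset.order G)"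
proof -
  have "{g \<in> carrier G. g [^] (1::nat) \<in> H} = H"
    using subgroup.subset[OF H] by auto
  moreover have "(\<Sum>g\<in>carrier G. perm_char H (g [^] (1::nat))) = (\<Sum>g\<in>carrier G. perm_char H g)"
    by simp
  ultimately show ?thesis
    using sum_perm_char_pow[OF H, of 1] card_subgroup_nonzero[OF H] by simp
qed

text \<open>Deleting one copy of \<open>c\<close> leaves a list whose sum is the difference. If that
  list is empty, the zero alternative in \<open>constituent\<close> applies.\<close>

lemma constituent_of_sum:
  assumes irr: "\<forall>c\<in>set cs. irreducible_character G c"
    and \<psi>: "\<And>g. g \<in> carrier G \<Longrightarrow> \<psi> g = (\<Sum>c\<leftarrow>cs. c g)" and c: "c \<in> set cs"
  shows "constituent G c \<psi>"
proof -
  let ?ds = "remove1 c cs"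
  let ?\<theta> = "\<lambda>g\<in>carrier G. \<psi> g - c g"
  have \<theta>: "?\<theta> = (\<lambda>g\<in>carrier G. \<Sum>d\<leftarrow>?ds. d g)"
    by (rule restrict_ext) (simp add: \<psi> sum_list_map_remove1[OF c])
  have "is_character G ?\<theta> \<or> (\<forall>g\<in>carrier G. ?\<theta> g = 0)"
  proof (cases "?ds = []")
    case True
    then show ?thesis unfolding \<theta> by simp
  next
    case False
    moreover have "\<forall>d\<in>set ?ds. is_character G d"
      using irr irreducible_imp_is_character set_remove1_subset by fastforce
    ultimately show ?thesis unfolding \<theta> using is_character_sum_list by blast
  qed
  moreover have "is_character G c" using irr c irreducible_imp_is_character by blast
  ultimately show ?thesis unfolding constituent_def Let_def by blast
qed

lemma perm_char_decomposition:
  assumes H: "subgroup H G"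
  obtains cs where "\<forall>c\<in>set cs. irreducible_character G c \<and> c \<noteq> (\<lambda>g\<in>carrier G. 1)"
    "irreducible_character G (\<lambda>g\<in>carrier G. 1)"
    "constituent G (\<lambda>g\<in>carrier G. 1) (perm_char H)"
    "\<forall>c\<in>set cs. constituent G c (perm_char H)"
    "\<And>g. g \<in> carrier G \<Longrightarrow> perm_char H g = 1 + (\<Sum>c\<leftarrow>cs. c g)"
proof -
  let ?triv = "\<lambda>g\<in>carrier G. 1 :: complex" and ?N = "of_nat (Coset.order G) :: complex"
  obtain n \<rho> where rep: "matrix_representation G n \<rho>"
    and tr: "\<And>g. g \<in> carrier G \<Longrightarrow> mat_trace (\<rho> g) = perm_char H g"
    by (rule perm_char_afforded[OF H]) (rule that)
  obtain cs where irr: "\<forall>c\<in>set cs. irreducible_character G c"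
    and cs: "\<And>g. g \<in> carrier G \<Longrightarrow> perm_char H g = (\<Sum>c\<leftarrow>cs. c g)"
    using character_decomposition[OF rep] tr by metis
  have sum0: "(\<Sum>g\<in>carrier G. c g) = 0" if "irreducible_character G c" "c \<noteq> ?triv" for c
    using irreducible_sum_nonzero that by blast
  have sum_swap: "(\<Sum>g\<in>carrier G. \<Sum>c\<leftarrow>ds. c g) = (\<Sum>c\<leftarrow>ds. \<Sum>g\<in>carrier G. c g)"
    for ds :: "('a \<Rightarrow> complex) list"
    by (induction ds) (simp_all add: sum.distrib)
  have total: "(\<Sum>c\<leftarrow>cs. \<Sum>g\<in>carrier G. c g) = ?N"
    unfolding sum_swap[symmetric] sum_perm_char[OF H, symmetric] by (intro sum.cong) (simp_all add: cs)
  have triv: "?triv \<in> set cs"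
  proof (rule ccontr)
    assume "?triv \<notin> set cs"
    then have "\<forall>c\<in>set cs. (\<Sum>g\<in>carrier G. c g) = 0" using irr sum0 by metis
    then have "(\<Sum>c\<leftarrow>cs. \<Sum>g\<in>carrier G. c g) = 0" by (simp add: sum_list_0 cong: map_cong)
    then show False using total order_nonzero by simp
  qed
  let ?ds = "remove1 ?triv cs"
  have sub: "set ?ds \<subseteq> set cs" by (rule set_remove1_subset)
  have zero: "(\<Sum>c\<leftarrow>?ds. \<Sum>g\<in>carrier G. c g) = 0"
    using total sum_list_map_remove1[OF triv, of "\<lambda>c. \<Sum>g\<in>carrier G. c g"]
    by (simp add: Coset.order_def)
  \<comment> \<open>Only copies of the principal character contribute to the total, each by the
    group order. Since \<open>zero\<close> holds after one copy has been removed, no second copy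
    remains.\<close>
  have count: "(\<Sum>c\<leftarrow>ds. \<Sum>g\<in>carrier G. c g) = of_nat (count_list ds ?triv) * ?N"
    if "\<forall>c\<in>set ds. irreducible_character G c" for ds
    using that by (induction ds) (auto simp: sum0 Coset.order_def algebra_simps)
  have "\<forall>c\<in>set ?ds. irreducible_character G c" using irr sub by blast
  from count[OF this] have "of_nat (count_list ?ds ?triv) * ?N = 0" unfolding zero ..
  then have "?triv \<notin> set ?ds"
    using order_nonzero count_list_0_iff by (metis mult_eq_0_iff of_nat_eq_0_iff)
  then have "\<forall>c\<in>set ?ds. irreducible_character G c \<and> c \<noteq> ?triv" using irr sub by blast
  moreover have "perm_char H g = 1 + (\<Sum>c\<leftarrow>?ds. c g)" if "g \<in> carrier G" for g
    using sum_list_map_remove1[OF triv, of "\<lambda>c. c g"] that by (simp add: cs)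
  moreover have con: "constituent G c (perm_char H)" if "c \<in> set cs" for c
    by (rule constituent_of_sum[OF irr cs that])
  moreover have "\<forall>c\<in>set ?ds. constituent G c (perm_char H)" using con sub by blast
  moreover have "irreducible_character G ?triv" using irr triv by blast
  ultimately show ?thesis using that[of ?ds] triv by blast
qed

text \<open>The average of \<open>\<rho>\<close> over \<open>K\<close> is the projection onto the \<open>K\<close>-fixed vectors; \<open>m\<close> is its corank.\<close>

lemma subgroup_average_trace:
  assumes rep: "matrix_representation G n \<rho>" and K: "subgroup K G"
  obtains m where "(\<Sum>k\<in>K. mat_trace (\<rho> k)) = of_nat (card K) * (of_nat n - of_nat m)"
    "m = 0 \<Longrightarrow> \<forall>k\<in>K. \<rho> k = 1\<^sub>m n"
proof -
  have KG: "k \<in> carrier G" if "k \<in> K" for k using subgroup.subset[OF K] that by blast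
  note c = rep_carrier[OF rep KG]
  let ?N = "of_nat (card K) :: complex"
  have N0: "?N \<noteq> 0" by (rule card_subgroup_nonzero[OF K])
  define P where "P = sum_mat n (\<lambda>k. inverse ?N \<cdot>\<^sub>m \<rho> k) K"
  have P: "P \<in> carrier_mat n n" by (simp add: P_def sum_mat_carrier)
  have \<rho>P: "\<rho> h * P = P" if h: "h \<in> K" for h
  proof -
    have bij: "bij_betw (\<lambda>k. h \<otimes> k) K K"
      by (rule bij_betw_byWitness[where f' = "\<lambda>k. inv h \<otimes> k"])
        (use h K KG in \<open>auto simp: m_assoc[symmetric] subgroup.m_closed subgroup.m_inv_closed\<close>)
    have "\<rho> h * P = sum_mat n (\<lambda>k. \<rho> h * (inverse ?N \<cdot>\<^sub>m \<rho> k)) K"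
      unfolding P_def by (rule mult_sum_mat) (use c h in auto)
    also have "\<dots> = sum_mat n (\<lambda>k. inverse ?N \<cdot>\<^sub>m \<rho> (h \<otimes> k)) K"
      by (rule sum_mat_cong) (simp add: mult_smult_distrib[OF c[OF h] c] rep_mult[OF rep KG[OF h] KG])
    also have "\<dots> = P" unfolding P_def by (rule sum_mat_reindex[OF bij])
    finally show ?thesis .
  qed
  have "P * P = sum_mat n (\<lambda>k. (inverse ?N \<cdot>\<^sub>m \<rho> k) * P) K"
    by (subst (1) P_def, rule sum_mat_mult) (use c P in auto)
  also have "\<dots> = sum_mat n (\<lambda>k. inverse ?N \<cdot>\<^sub>m P) K"
    by (rule sum_mat_cong) (simp add: mult_smult_assoc_mat[OF c P] \<rho>P)
  also have "\<dots> = P"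
    using P N0 by (intro eq_matI) (auto simp: sum_mat_def)
  finally have PP: "P * P = P" .
  \<comment> \<open>\<open>idempotent_trace\<close> is applied to the complementary projection, so
    that \<open>m = 0\<close> means that \<open>P\<close> is the identity; then
    \<open>\<rho> k * P = P\<close> makes every \<open>\<rho> k\<close> trivial.\<close>
  let ?Q = "1\<^sub>m n - P"
  have Q: "?Q \<in> carrier_mat n n" using P by (rule minus_carrier_mat)
  have "?Q * ?Q = ?Q * 1\<^sub>m n - ?Q * P" by (rule mult_minus_distrib_mat[OF Q _ P]) simp
  also have "?Q * P = 1\<^sub>m n * P - P * P" by (rule minus_mult_distrib_mat[OF _ P P]) simp
  also have "\<dots> = 0\<^sub>m n n" using P PP by simp
  also have "?Q * 1\<^sub>m n - 0\<^sub>m n n = ?Q" using P by (intro eq_matI) auto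
  finally have "?Q * ?Q = ?Q" .
  then obtain m where m: "mat_trace ?Q = of_nat m" "m = 0 \<Longrightarrow> ?Q = 0\<^sub>m n n"
    by (rule idempotent_trace[OF Q]) (rule that)
  have "mat_trace P = (\<Sum>k\<in>K. mat_trace (inverse ?N \<cdot>\<^sub>m \<rho> k))"
    unfolding P_def by (rule mat_trace_sum_mat) (use c in auto)
  also have "\<dots> = (\<Sum>k\<in>K. inverse ?N * mat_trace (\<rho> k))"
  proof (rule sum.cong)
    fix k assume "k \<in> K"
    from c[OF this] show "mat_trace (inverse ?N \<cdot>\<^sub>m \<rho> k) = inverse ?N * mat_trace (\<rho> k)"
      by (auto simp: mat_trace_def sum_distrib_left)
  qed simp
  finally have trP: "?N * mat_trace P = (\<Sum>k\<in>K. mat_trace (\<rho> k))"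
    using N0 by (simp add: sum_distrib_left[symmetric])
  have "mat_trace ?Q = of_nat n - mat_trace P"
    using P by (simp add: mat_trace_eq[OF Q] mat_trace_eq[OF P] sum_subtractf)
  then have "(\<Sum>k\<in>K. mat_trace (\<rho> k)) = ?N * (of_nat n - of_nat m)"
    using m(1) by (simp flip: trP)
  moreover have "\<forall>k\<in>K. \<rho> k = 1\<^sub>m n" if "m = 0"
  proof
    fix k assume k: "k \<in> K"
    have "P = 1\<^sub>m n"
    proof (rule eq_matI)
      fix i j assume ij: "i < dim_row (1\<^sub>m n :: complex mat)" "j < dim_col (1\<^sub>m n :: complex mat)"
      have "?Q $$ (i, j) = 0" unfolding m(2)[OF that] using ij by simp
      then show "P $$ (i, j) = 1\<^sub>m n $$ (i, j)" using P ij by simp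
    qed (use P in auto)
    then show "\<rho> k = 1\<^sub>m n" using \<rho>P[OF k] c[OF k] by simp
  qed
  ultimately show ?thesis by (rule that)
qed

section \<open>The normal core and its action on constituents\<close>

lemma mem_normal_core_iff:
  assumes "subgroup H G"
  shows "k \<in> normal_core G H \<longleftrightarrow> k \<in> carrier G \<and> (\<forall>x\<in>carrier G. x \<otimes> k \<otimes> inv x \<in> H)"
proof -
  have HG: "H \<subseteq> carrier G" by (rule subgroup.subset[OF assms])
  have *: "k \<in> conjugate_subgroup G H x \<longleftrightarrow> k \<in> carrier G \<and> x \<otimes> k \<otimes> inv x \<in> H"
    if x: "x \<in> carrier G" for x
  proof
    assume "k \<in> conjugate_subgroup G H x"
    then obtain h where h: "h \<in> H" "k = inv x \<otimes> h \<otimes> x" by (auto simp: conjugate_subgroup_def)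
    have hG: "h \<in> carrier G" using h HG by blast
    have "x \<otimes> k \<otimes> inv x = h"
      unfolding h(2) using x hG by (simp add: m_assoc mult_inv_cancel)
    then show "k \<in> carrier G \<and> x \<otimes> k \<otimes> inv x \<in> H" using h x hG by simp
  next
    assume k: "k \<in> carrier G \<and> x \<otimes> k \<otimes> inv x \<in> H"
    have "k = inv x \<otimes> (x \<otimes> k \<otimes> inv x) \<otimes> x"
      using x k by (simp add: m_assoc inv_mult_cancel)
    then show "k \<in> conjugate_subgroup G H x" using k unfolding conjugate_subgroup_def by blast
  qed
  show ?thesis unfolding normal_core_def using * one_closed by blast
qed

lemma normal_core_normal:
  assumes H: "subgroup H G"
  shows "normal_core G H \<lhd> G"
proof (rule normal_invI)
  note mem = mem_normal_core_iff[OF H]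
  show "subgroup (normal_core G H) G"
  proof (rule subgroupI)
    show "normal_core G H \<subseteq> carrier G" using mem by blast
    show "normal_core G H \<noteq> {}" using mem[of \<one>] subgroup.one_closed[OF H] by auto
    fix a assume a: "a \<in> normal_core G H"
    show "inv a \<in> normal_core G H"
      unfolding mem
    proof (intro conjI ballI)
      show "inv a \<in> carrier G" using a mem by simp
      fix x assume x: "x \<in> carrier G"
      have "x \<otimes> inv a \<otimes> inv x = inv (x \<otimes> a \<otimes> inv x)"
        using a x mem[of a] by (simp add: inv_mult_group m_assoc)
      then show "x \<otimes> inv a \<otimes> inv x \<in> H" using a x mem[of a] subgroup.m_inv_closed[OF H] by simp
    qed
    fix b assume b: "b \<in> normal_core G H"
    show "a \<otimes> b \<in> normal_core G H"
      unfolding mem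
    proof (intro conjI ballI)
      show "a \<otimes> b \<in> carrier G" using a b mem by simp
      fix x assume x: "x \<in> carrier G"
      have "(x \<otimes> a \<otimes> inv x) \<otimes> (x \<otimes> b \<otimes> inv x) = x \<otimes> (a \<otimes> b) \<otimes> inv x"
        using a b x mem[of a] mem[of b] by (simp add: m_assoc inv_mult_cancel)
      then show "x \<otimes> (a \<otimes> b) \<otimes> inv x \<in> H"
        using a b x mem subgroup.m_closed[OF H] by metis
    qed
  qed
  fix x h assume x: "x \<in> carrier G" and h: "h \<in> normal_core G H"
  show "x \<otimes> h \<otimes> inv x \<in> normal_core G H"
    unfolding mem
  proof (intro conjI ballI)
    show "x \<otimes> h \<otimes> inv x \<in> carrier G" using x h mem by simp
    fix y assume y: "y \<in> carrier G"
    have "y \<otimes> (x \<otimes> h \<otimes> inv x) \<otimes> inv y = (y \<otimes> x) \<otimes> h \<otimes> inv (y \<otimes> x)"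
      using x y h mem[of h] by (simp add: m_assoc inv_mult_group)
    then show "y \<otimes> (x \<otimes> h \<otimes> inv x) \<otimes> inv y \<in> H" using x y h mem[of h] by simp
  qed
qed

text \<open>The permutation character is constant on the core, so its average there equals its
  degree. That average is also the sum of those of the constituent and of the complement, which fall
  short of their degrees by the coranks \<open>m\<close> and \<open>l\<close>. Hence the natural
  number \<open>m + l\<close> is 0.\<close>

lemma constituent_perm_char_kernel:
  assumes H: "subgroup H G" and rep: "matrix_representation G n \<rho>"
    and con: "constituent G (afforded_character G \<rho>) (perm_char H)" and k: "k \<in> normal_core G H"
  shows "\<rho> k = 1\<^sub>m n"
proof -
  let ?K = "normal_core G H" and ?\<theta> = "\<lambda>g\<in>carrier G. perm_char H g - afforded_character G \<rho> g"
  have K: "subgroup ?K G" by (rule normal_imp_subgroup[OF normal_core_normal[OF H]])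
  have KG: "k \<in> carrier G" if "k \<in> ?K" for k using subgroup.subset[OF K] that by blast
  have tr1: "mat_trace (\<sigma> \<one>) = of_nat l" if "matrix_representation G l \<sigma>" for l \<sigma>
    by (simp add: rep_one[OF that] mat_trace_def)
  \<comment> \<open>For an element of the core every conjugate lies in \<open>H\<close>, so every
    summand of the induced character equals 1, just as at the identity.\<close>
  have \<pi>: "perm_char H k = perm_char H \<one>" if "k \<in> ?K" for k
    using that mem_normal_core_iff[OF H] subgroup.one_closed[OF H] by (simp add: perm_char_eq)
  obtain m where m: "(\<Sum>k\<in>?K. mat_trace (\<rho> k)) = of_nat (card ?K) * (of_nat n - of_nat m)"
    "m = 0 \<Longrightarrow> \<forall>k\<in>?K. \<rho> k = 1\<^sub>m n"
    by (rule subgroup_average_trace[OF rep K]) (rule that)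
  have "is_character G ?\<theta> \<or> (\<forall>g\<in>carrier G. ?\<theta> g = 0)"
    using con unfolding constituent_def Let_def by blast
  \<comment> \<open>\<open>l\<close> is the corank belonging to the difference; when the difference
    vanishes identically, it affords no representation and \<open>l = 0\<close> fits.\<close>
  then obtain l where l: "(\<Sum>k\<in>?K. ?\<theta> k) = of_nat (card ?K) * (?\<theta> \<one> - of_nat l)"
  proof
    assume "is_character G ?\<theta>"
    then obtain d \<sigma> where \<sigma>: "matrix_representation G d \<sigma>" "?\<theta> = afforded_character G \<sigma>"
      unfolding is_character_def by blast
    obtain l where "(\<Sum>k\<in>?K. mat_trace (\<sigma> k)) = of_nat (card ?K) * (of_nat d - of_nat l)"
      by (rule subgroup_average_trace[OF \<sigma>(1) K]) (rule that)
    then have "(\<Sum>k\<in>?K. ?\<theta> k) = of_nat (card ?K) * (?\<theta> \<one> - of_nat l)"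
      unfolding \<sigma>(2) using KG by (simp add: afforded_character_def tr1[OF \<sigma>(1)])
    then show ?thesis by (rule that)
  next
    assume z: "\<forall>g\<in>carrier G. ?\<theta> g = 0"
    have "(\<Sum>k\<in>?K. ?\<theta> k) = 0" by (rule sum.neutral) (use z KG in blast)
    then show ?thesis using that[of 0] z one_closed by (metis diff_zero mult_zero_right of_nat_0)
  qed
  have "of_nat (card ?K) * perm_char H \<one> = (\<Sum>k\<in>?K. perm_char H k)" by (simp add: \<pi>)
  also have "\<dots> = (\<Sum>k\<in>?K. ?\<theta> k + mat_trace (\<rho> k))"
    using KG by (intro sum.cong) (auto simp: afforded_character_def)
  also have "\<dots> = of_nat (card ?K) * (?\<theta> \<one> - of_nat l + (of_nat n - of_nat m))"
    by (simp only: sum.distrib l m(1) distrib_left)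
  also have "?\<theta> \<one> = perm_char H \<one> - of_nat n" by (simp add: afforded_character_def tr1[OF rep])
  finally have "of_nat (card ?K) * (of_nat (m + l) :: complex) = 0"
    by (simp add: algebra_simps)
  then have "(of_nat (m + l) :: complex) = 0"
    using card_subgroup_nonzero[OF K] by (metis mult_eq_0_iff)
  then have "m = 0" by (metis add_is_0 of_nat_eq_0_iff)
  with m(2) k show ?thesis by blast
qed

section \<open>Squaring in the quotient by a normal subgroup\<close>

lemma sum_squares_odd_index:
  fixes f :: "'a \<Rightarrow> complex"
  assumes K: "K \<lhd> G" and odd: "odd (card (rcosets K))"
    and f: "\<And>k g. k \<in> K \<Longrightarrow> g \<in> carrier G \<Longrightarrow> f (k \<otimes> g) = f g"
  shows "(\<Sum>g\<in>carrier G. f (g [^] (2::nat))) = (\<Sum>g\<in>carrier G. f g)"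
proof -
  have Ks: "subgroup K G" by (rule normal_imp_subgroup[OF K])
  interpret Q: group "G Mod K" by (rule normal.factorgroup_is_group[OF K])
  have finQ: "finite (carrier (G Mod K))"
    using fin rcosets_subset_PowG[OF Ks] by (simp add: finite_subset FactGroup_def)
  have QO: "C [^]\<^bsub>G Mod K\<^esub> card (rcosets K) = \<one>\<^bsub>G Mod K\<^esub>" if "C \<in> carrier (G Mod K)" for C
    using Q.pow_order_eq_1[OF that] by (simp add: Coset.order_def FactGroup_def)
  obtain j where j: "card (rcosets K) = 2 * j + 1" using odd oddE by blast
  \<comment> \<open>With quotient order \<open>2 * j + 1\<close>, the exponent
    \<open>2 * (j + 1)\<close> is one more than the order, so raising to the power
    \<open>j + 1\<close> undoes squaring.\<close>
  have root: "(C [^]\<^bsub>G Mod K\<^esub> (2::nat)) [^]\<^bsub>G Mod K\<^esub> (j + 1) = C" if C: "C \<in> carrier (G Mod K)" for C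
  proof -
    have "(C [^]\<^bsub>G Mod K\<^esub> (2::nat)) [^]\<^bsub>G Mod K\<^esub> (j + 1) = C [^]\<^bsub>G Mod K\<^esub> (2 * (j + 1))"
      by (rule Q.nat_pow_pow[OF C])
    also have "2 * (j + 1) = Suc (card (rcosets K))" using j by simp
    also have "C [^]\<^bsub>G Mod K\<^esub> \<dots> = C" unfolding Q.nat_pow_Suc QO[OF C] by (rule Q.l_one[OF C])
    finally show ?thesis .
  qed
  have inj: "inj_on (\<lambda>C. C [^]\<^bsub>G Mod K\<^esub> (2::nat)) (carrier (G Mod K))"
    by (rule inj_on_inverseI[where g = "\<lambda>C. C [^]\<^bsub>G Mod K\<^esub> (j + 1)"]) (rule root)
  have "(\<lambda>C. C [^]\<^bsub>G Mod K\<^esub> (2::nat)) ` carrier (G Mod K) = carrier (G Mod K)"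
    by (rule endo_inj_surj[OF finQ _ inj]) auto
  then have bij: "bij_betw (\<lambda>C. C [^]\<^bsub>G Mod K\<^esub> (2::nat)) (rcosets K) (rcosets K)"
    using inj by (simp add: bij_betw_def FactGroup_def)
  \<comment> \<open>\<open>F\<close> is \<open>f\<close> viewed on cosets; invariance of
    \<open>f\<close> under \<open>K\<close> makes the choice of representative irrelevant.\<close>
  define F where "F C = f (SOME g. g \<in> C)" for C
  have F: "F (K #> g) = f g" if g: "g \<in> carrier G" for g
  proof -
    have "(SOME g'. g' \<in> K #> g) \<in> K #> g" using rcos_self[OF g Ks] by (rule someI)
    then obtain k where "k \<in> K" "(SOME g'. g' \<in> K #> g) = k \<otimes> g" by (auto simp: r_coset_def)
    then show ?thesis using f g by (simp add: F_def)
  qed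
  have sq: "(K #> g) [^]\<^bsub>G Mod K\<^esub> (2::nat) = K #> g [^] (2::nat)" if "g \<in> carrier G" for g
  proof -
    have "K #> g \<in> carrier (G Mod K)" using that by (auto simp: FactGroup_def RCOSETS_def)
    then have "(K #> g) [^]\<^bsub>G Mod K\<^esub> (2::nat) = (K #> g) \<otimes>\<^bsub>G Mod K\<^esub> (K #> g)"
      unfolding numeral_2_eq_2 Q.nat_pow_Suc Q.nat_pow_0 by (simp only: Q.l_one)
    also have "\<dots> = K #> (g \<otimes> g)"
      using normal.rcos_sum[OF K that that] by (simp add: FactGroup_def)
    finally show ?thesis using that by (simp add: numeral_2_eq_2)
  qed
  have "(\<Sum>g\<in>carrier G. f (g [^] (2::nat))) = (\<Sum>g\<in>carrier G. F ((K #> g) [^]\<^bsub>G Mod K\<^esub> (2::nat)))"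
    by (intro sum.cong) (simp_all add: sq F)
  also have "\<dots> = of_nat (card K) * (\<Sum>C\<in>rcosets K. F (C [^]\<^bsub>G Mod K\<^esub> (2::nat)))"
    by (rule sum_rcosets[OF Ks])
  also have "(\<Sum>C\<in>rcosets K. F (C [^]\<^bsub>G Mod K\<^esub> (2::nat))) = (\<Sum>C\<in>rcosets K. F C)"
    by (rule sum.reindex_bij_betw[OF bij])
  also have "of_nat (card K) * \<dots> = (\<Sum>g\<in>carrier G. F (K #> g))" by (rule sum_rcosets[OF Ks, symmetric])
  also have "\<dots> = (\<Sum>g\<in>carrier G. f g)" by (simp add: F)
  finally show ?thesis .
qed

text \<open>Sylow's theorem with exponent 1 gives a subgroup of order 2 in the quotient;
  \<open>t\<close> represents its nonidentity element.\<close>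

lemma even_index_square:
  assumes K: "K \<lhd> G" and even: "even (card (rcosets K))"
  obtains t where "t \<in> carrier G" "t \<notin> K" "t [^] (2::nat) \<in> K"
proof -
  have Ks: "subgroup K G" by (rule normal_imp_subgroup[OF K])
  interpret Q: group "G Mod K" by (rule normal.factorgroup_is_group[OF K])
  have finQ: "finite (carrier (G Mod K))"
    using fin rcosets_subset_PowG[OF Ks] by (simp add: finite_subset FactGroup_def)
  have "Coset.order (G Mod K) = 2 ^ 1 * (card (rcosets K) div 2)"
    using even by (simp add: Coset.order_def FactGroup_def)
  then obtain U where U: "subgroup U (G Mod K)" "card U = 2"
    using sylow_thm[OF _ Q.is_group _ finQ, of 2 1] two_is_prime_nat by auto
  then obtain A where A: "A \<in> U" "A \<noteq> \<one>\<^bsub>G Mod K\<^esub>"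
    by (metis One_nat_def card_1_singleton_iff card_2_iff' insertI1 subgroup.one_closed
        n_not_Suc_n numeral_2_eq_2)
  have AQ: "A \<in> carrier (G Mod K)" using A subgroup.subset[OF U(1)] by blast
  have "U = {\<one>\<^bsub>G Mod K\<^esub>, A}"
    using U A subgroup.one_closed[OF U(1)] by (metis card_2_iff doubleton_eq_iff insertE singletonD)
  moreover have "A \<otimes>\<^bsub>G Mod K\<^esub> A \<in> U" using subgroup.m_closed[OF U(1)] A by blast
  moreover have "A \<otimes>\<^bsub>G Mod K\<^esub> A \<noteq> A" using A AQ by (metis Q.l_cancel_one)
  ultimately have AA: "A \<otimes>\<^bsub>G Mod K\<^esub> A = \<one>\<^bsub>G Mod K\<^esub>" by blast
  obtain t where t: "t \<in> carrier G" "A = K #> t" using AQ by (auto simp: FactGroup_def RCOSETS_def)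
  have "t \<notin> K" using A(2) coset_join2[OF t(1) Ks] by (auto simp: t FactGroup_def)
  moreover have "K #> (t \<otimes> t) = K"
    using AA normal.rcos_sum[OF K t(1) t(1)] by (simp add: t(2) FactGroup_def)
  then have "t [^] (2::nat) \<in> K"
    using coset_join1[OF _ _ Ks] t by (simp add: numeral_2_eq_2)
  ultimately show ?thesis using that t by blast
qed

end

theorem theoremA:
  fixes G :: "('a, 'b) monoid_scheme" and H :: "'a set"
  assumes "group G" and "finite (carrier G)" and "subgroup H G"
  shows "(\<exists>!\<chi>. irreducible_character G \<chi>
              \<and> constituent G \<chi> (induced_character G H (principal_character H))
              \<and> real_valued G \<chi> \<and> plus_type G \<chi>)
         \<longleftrightarrow> odd (subgroup_index G (normal_core G H))"
    (is "(\<exists>!\<chi>. ?P \<chi>) \<longleftrightarrow> _")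
proof -
  interpret fin_group G using assms(1,2) by (simp add: fin_group_def fin_group_axioms_def)
  note H = assms(3)
  let ?K = "normal_core G H" and ?triv = "\<lambda>g\<in>carrier G. 1 :: complex"
  let ?N = "of_nat (Coset.order G) :: complex"
  note K = normal_core_normal[OF H]
  obtain cs where irr: "\<forall>c\<in>set cs. irreducible_character G c \<and> c \<noteq> ?triv"
    and triv: "irreducible_character G ?triv" "constituent G ?triv (perm_char H)"
    and con: "\<forall>c\<in>set cs. constituent G c (perm_char H)"
    and cs: "\<And>g. g \<in> carrier G \<Longrightarrow> perm_char H g = 1 + (\<Sum>c\<leftarrow>cs. c g)"
    by (rule perm_char_decomposition[OF H]) (rule that)
  have P_triv: "?P ?triv"
    using triv order_nonzero
    by (simp add: real_valued_def plus_type_def frobenius_schur_indicator_def Coset.order_def)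
  show ?thesis
  proof
    assume odd: "odd (subgroup_index G ?K)"
    have "\<chi> = ?triv" if \<chi>: "?P \<chi>" for \<chi>
    proof -
      obtain n \<rho> where \<rho>: "irreducible_representation G n \<rho>" "\<chi> = afforded_character G \<rho>"
        using \<chi> unfolding irreducible_character_def by blast
      then have rep: "matrix_representation G n \<rho>" by (simp add: irreducible_representation_def)
      have KG: "k \<in> carrier G" if "k \<in> ?K" for k
        using subgroup.subset[OF normal_imp_subgroup[OF K]] that by blast
      have "\<chi> (k \<otimes>\<^bsub>G\<^esub> g) = \<chi> g" if "k \<in> ?K" "g \<in> carrier G" for k g
        using constituent_perm_char_kernel[OF H rep _ that(1)] \<chi> KG[OF that(1)] that(2)
          rep_carrier[OF rep that(2)]
        by (simp add: \<rho>(2) afforded_character_def rep_mult[OF rep])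
      then have "(\<Sum>g\<in>carrier G. \<chi> g) = ?N * frobenius_schur_indicator G \<chi>"
        using sum_squares_odd_index[OF K _, of \<chi>] odd order_nonzero
        by (simp add: subgroup_index_def frobenius_schur_indicator_def)
      then have "(\<Sum>g\<in>carrier G. \<chi> g) \<noteq> 0" using \<chi> order_nonzero by (simp add: plus_type_def)
      then show ?thesis using irreducible_sum_nonzero \<chi> by blast
    qed
    with P_triv show "\<exists>!\<chi>. ?P \<chi>" by (rule ex1I)
  next
    assume uniq: "\<exists>!\<chi>. ?P \<chi>"
    show "odd (subgroup_index G ?K)"
    proof (rule ccontr)
      assume "\<not> odd (subgroup_index G ?K)"
      then obtain t where t: "t \<in> carrier G" "t \<notin> ?K" "t [^]\<^bsub>G\<^esub> (2::nat) \<in> ?K"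
        using even_index_square[OF K] unfolding subgroup_index_def by blast
      then obtain x where x: "x \<in> carrier G" "x \<otimes>\<^bsub>G\<^esub> t \<otimes>\<^bsub>G\<^esub> inv\<^bsub>G\<^esub> x \<notin> H"
        using mem_normal_core_iff[OF H] by blast
      let ?s = "x \<otimes>\<^bsub>G\<^esub> t \<otimes>\<^bsub>G\<^esub> inv\<^bsub>G\<^esub> x" and ?R = "{g \<in> carrier G. g [^]\<^bsub>G\<^esub> (2::nat) \<in> H}"
      have "?s [^]\<^bsub>G\<^esub> (2::nat) \<in> H"
        unfolding conj_pow[OF x(1) t(1)] using t(3) x(1) mem_normal_core_iff[OF H] by blast
      then have s: "?s \<in> ?R" using x t by simp
      have "H \<subseteq> ?R"
        using subgroup.subset[OF H] subgroup.m_closed[OF H] by (auto simp: numeral_2_eq_2)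
      with s x(2) have card: "card H < card ?R"
        using fin by (intro psubset_card_mono) auto
      \<comment> \<open>An indicator equal to 1 would give a second character satisfying
        \<open>?P\<close>, its real values coming from the trichotomy. The only other values are 0
        and -1.\<close>
      have nonpos: "Re (frobenius_schur_indicator G c) \<le> 0" if c: "c \<in> set cs" for c
      proof -
        have "frobenius_schur_indicator G c \<noteq> 1"
        proof
          assume "frobenius_schur_indicator G c = 1"
          then have "?P c"
            using irr con c frobenius_schur_trichotomy(2)[of c] by (simp add: plus_type_def)
          then show False using uniq P_triv irr c by blast
        qed
        then show ?thesis using frobenius_schur_trichotomy(1)[of c] irr c by auto
      qed
      have "(\<Sum>g\<in>carrier G. perm_char H (g [^]\<^bsub>G\<^esub> (2::nat)))
          = (\<Sum>g\<in>carrier G. 1 + (\<Sum>c\<leftarrow>cs. c (g [^]\<^bsub>G\<^esub> (2::nat))))"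
        by (intro sum.cong) (simp_all add: cs)
      also have "\<dots> = ?N + (\<Sum>c\<leftarrow>cs. \<Sum>g\<in>carrier G. c (g [^]\<^bsub>G\<^esub> (2::nat)))"
      proof -
        have "(\<Sum>g\<in>carrier G. \<Sum>c\<leftarrow>ds. c (g [^]\<^bsub>G\<^esub> (2::nat)))
            = (\<Sum>c\<leftarrow>ds. \<Sum>g\<in>carrier G. c (g [^]\<^bsub>G\<^esub> (2::nat)))" for ds :: "('a \<Rightarrow> complex) list"
          by (induction ds) (simp_all add: sum.distrib)
        then show ?thesis by (simp add: sum.distrib Coset.order_def)
      qed
      also have "\<dots> = ?N * (1 + (\<Sum>c\<leftarrow>cs. frobenius_schur_indicator G c))"
        using order_nonzero
        by (simp add: frobenius_schur_indicator_def distrib_left flip: sum_list_const_mult)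
      finally have "1 + (\<Sum>c\<leftarrow>cs. frobenius_schur_indicator G c) = of_nat (card ?R) / of_nat (card H)"
        using sum_perm_char_pow[OF H, of 2] order_nonzero by (simp flip: times_divide_eq_right)
      \<comment> \<open>The indicators are complex numbers, so the inequalities are read off from
        real parts.\<close>
      then have "Re (1 + (\<Sum>c\<leftarrow>cs. frobenius_schur_indicator G c)) = real (card ?R) / real (card H)"
        by (metis Re_complex_of_real of_real_divide of_real_of_nat_eq)
      moreover have "Re (\<Sum>c\<leftarrow>cs. frobenius_schur_indicator G c) \<le> 0"
        using nonpos by (induction cs) (auto intro: add_nonpos_nonpos)
      moreover have "real (card ?R) / real (card H) > 1"
        using card card_subgroup_nonzero[OF H] by simp
      ultimately show False by simp
    qed
  qed
qed

end
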